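(* For every real $B>1$, \[ \dim_H F(B)=s_B,\qquad\text{where } F(B)=\{x\in I_{even}\colon a_{2n}(x)\ge B^{2n}\text{ for infinitely many } n\}. \]
   Context: Every $x\in[0,1)$ has a regular continued fraction expansion $x=[0;a_1(x),a_2(x),\ldots]$ (finite if $x$ is rational). $I_{even}$ is the set of $x\in[0,1)$ whose partial quotients satisfy $a_{2k+1}(x)=1$ for all $k\ge0$ (i.e. all odd-order partial quotients equal $1$). For positive integers $a_2,a_4,\ldots,a_{2n}$, let $q_{2n}=q_{2n}(1,a_2,1,a_4,\ldots,1,a_{2n})$ be the denominator of the convergent $[0;1,a_2,1,a_4,\ldots,1,a_{2n}]$, defined by $q_{-1}=0$, $q_0=1$, $q_k=c_kq_{k-1}+q_{k-2}$ for the sequence $(c_1,\ldots,c_{2n})=(1,a_2,1,\ldots,1,a_{2n})$. For $B>1$, \[ s_B=\lim_{n\to\infty}\inf\Big\{\rho\ge0\colon \sum_{a_2,a_4,\ldots,a_{2n}\in\mathbb{N}}\frac{1}{(B^{2n}q_{2n}^2)^\rho}\le1\Big\} \] (this limit exists). $\dim_H$ denotes Hausdorff dimension. *)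

theory Defs
  imports "HOL-Analysis.Analysis"
begin

section \<open>Regular continued fractions\<close>

definition gauss_map :: "real \<Rightarrow> real" where
  "gauss_map x = (if x = 0 then 0 else frac (1 / x))"

text \<open>
  For \<open>x\<close> in \<open>[0,1)\<close>, \<open>partial_quotient x n\<close> (\<open>n \<ge> 1\<close>) is the \<open>n\<close>-th digit of the expansion
  \<open>x = [0; a\<^sub>1, a\<^sub>2, \<dots>]\<close>. Existing digits are positive; the value \<open>0\<close> (from \<open>1 / 0 = 0\<close>) means
  that the expansion of a rational \<open>x\<close> has ended before position \<open>n\<close>. The index \<open>0\<close> is not used.
\<close>
definition partial_quotient :: "real \<Rightarrow> nat \<Rightarrow> nat" where
  "partial_quotient x n = nat \<lfloor>1 / (gauss_map ^^ (n - 1)) x\<rfloor>"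

text \<open>
  \<open>cf_denom c k\<close> is \<open>q\<^sub>k\<close> for the digits \<open>c 1, c 2, \<dots>\<close>; the second equation is the recurrence
  with \<open>q\<^sub>0 = 1\<close> and \<open>q\<^sub>-\<^sub>1 = 0\<close>.
\<close>
fun cf_denom :: "(nat \<Rightarrow> nat) \<Rightarrow> nat \<Rightarrow> nat" where
  "cf_denom c 0 = 1"
| "cf_denom c (Suc 0) = c 1"
| "cf_denom c (Suc (Suc k)) = c (Suc (Suc k)) * cf_denom c (Suc k) + cf_denom c k"

text \<open>The digit sequence \<open>1, a\<^sub>2, 1, a\<^sub>4, \<dots>\<close>, where \<open>a\<^sub>2\<^sub>k\<close> is given as \<open>b k\<close>.\<close>
definition interleave_ones :: "(nat \<Rightarrow> nat) \<Rightarrow> nat \<Rightarrow> nat" where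
  "interleave_ones b k = (if odd k then 1 else b (k div 2))"


section \<open>Hausdorff dimension\<close>

text \<open>
  The factor \<open>(diam U)\<^sup>s\<close>, with the usual conventions that the empty set contributes \<open>0\<close> and a
  nonempty set contributes \<open>1\<close> for \<open>s = 0\<close> (whereas \<open>0 powr 0 = 0\<close>).
\<close>
definition diam_powr :: "real \<Rightarrow> 'a::metric_space set \<Rightarrow> ennreal" where
  "diam_powr s U =
    (if U = {} then 0 else if s = 0 then 1 else ennreal (diameter U powr s))"

text \<open>Boundedness is required because \<^const>\<open>diameter\<close> has no useful value on unbounded sets.\<close>
definition hausdorff_premeasure :: "real \<Rightarrow> real \<Rightarrow> 'a::metric_space set \<Rightarrow> ennreal" where
  "hausdorff_premeasure s \<delta> A =
    (INF U \<in> {U :: nat \<Rightarrow> 'a set. A \<subseteq> (\<Union>i. U i) \<and> (\<forall>i. bounded (U i) \<and> diameter (U i) \<le> \<delta>)}.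
      \<Sum>i. diam_powr s (U i))"

definition hausdorff_measure :: "real \<Rightarrow> 'a::metric_space set \<Rightarrow> ennreal" where
  "hausdorff_measure s A = (SUP \<delta> \<in> {0<..}. hausdorff_premeasure s \<delta> A)"

definition hausdorff_dim :: "'a::metric_space set \<Rightarrow> ereal" where
  "hausdorff_dim A = (INF s \<in> {s. 0 \<le> s \<and> hausdorff_measure s A = 0}. ereal s)"


section \<open>The exceptional set and its critical exponent\<close>

definition I_even :: "real set" where
  "I_even = {x \<in> {0..<1}. \<forall>k. partial_quotient x (2 * k + 1) = 1}"

definition F_set :: "real \<Rightarrow> real set" where
  "F_set B = {x \<in> I_even. \<exists>\<^sub>\<infinity>n. real (partial_quotient x (2 * n)) \<ge> B ^ (2 * n)}"

text \<open>
  The tuple \<open>(a\<^sub>2, a\<^sub>4, \<dots>, a\<^sub>2\<^sub>n)\<close> of positive integers is a function on \<open>{1..n}\<close>; the sum is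
  taken in the extended nonnegative reals, so that it is \<open>\<infinity>\<close> when divergent.
\<close>
definition s_level_sum :: "real \<Rightarrow> nat \<Rightarrow> real \<Rightarrow> ennreal" where
  "s_level_sum B n \<rho> =
    (\<Sum>\<^sub>\<infinity>b \<in> {1..n} \<rightarrow>\<^sub>E {1..}.
      ennreal (1 / (B ^ (2 * n) * real (cf_denom (interleave_ones b) (2 * n)) ^ 2) powr \<rho>))"

definition s_level :: "real \<Rightarrow> nat \<Rightarrow> real" where
  "s_level B n = Inf {\<rho>. 0 \<le> \<rho> \<and> s_level_sum B n \<rho> \<le> 1}"

definition s_limit :: "real \<Rightarrow> real" where
  "s_limit B = lim (s_level B)"

end

theory Submission
  imports Defs
begin

text \<open>
  Two steps of the Gauss map on \<open>I_even\<close> have the inverse branches \<open>y \<mapsto> 1 - 1 / (b + 1 + y)\<close>, and the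
  composition along \<open>w = (a\<^sub>2, \<dots>, a\<^sub>2\<^sub>n)\<close> contracts distances by \<open>q\<^sub>2\<^sub>n\<^sup>2\<close> up to a factor \<open>4\<close>.
  The level sums are submultiplicative, so \<open>s_level B n\<close> tends to its infimum over \<open>n \<ge> 1\<close>, and for
  every larger exponent they decay exponentially.

  Upper bound: the points with digits \<open>w\<close> whose next even digit is at least \<open>B\<^sup>2\<^sup>n\<close> lie in a set of
  diameter at most \<open>1 / (B\<^sup>2\<^sup>n q\<^sub>2\<^sub>n\<^sup>2)\<close>, so the tails of the level sums bound the Hausdorff measure.

  Lower bound, for \<open>s\<close> below the limit: the factor \<open>B\<^sup>2\<^sup>n\<close> leaves enough room to find, by pigeonhole over
  dyadic classes of denominators, a finite set of words of equal length, all with denominators of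
  size about \<open>Q\<close>, whose cardinality is at least \<open>2 (B\<^sup>2\<^sup>L Q\<^sup>2)\<^sup>s\<close>. Mixed radix digits of
  \<open>t \<in> [0,1)\<close> then select a point \<open>x(t)\<close>: ordinary stages choose a word from this set, and once
  sufficient mass has been gained a special stage chooses one digit uniformly between \<open>X\<close> and
  \<open>2X\<close>, where \<open>X\<close> is about \<open>B\<^sup>2\<^sup>n\<close>. Hence \<open>\<bar>t - t'\<bar> \<le> C \<bar>x(t) - x(t')\<bar>\<^sup>s\<close>, and comparing covers of the
  image with Lebesgue measure on \<open>[0,1)\<close> shows that the \<open>s\<close>-dimensional measure is positive.
\<close>

section \<open>Inverse branches and their denominators\<close>

text \<open>[0; 1, b + y] = 1 / (1 + 1 / (b + y)) = 1 - 1 / (b + 1 + y); in this form y occurs once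
  and each branch is visibly increasing.\<close>

primrec branch :: "nat list \<Rightarrow> real \<Rightarrow> real" where
  "branch [] x = x"
| "branch (b # w) x = 1 - 1 / (real b + 1 + branch w x)"

text \<open>For a word of length n this is q_2n + x q_(2n-1), and 1 / (denom w x)^2 is the
  derivative of \<open>branch w\<close> at x.\<close>

primrec denom :: "nat list \<Rightarrow> real \<Rightarrow> real" where
  "denom [] x = 1"
| "denom (b # w) x = (real b + 1 + branch w x) * denom w x"

lemma branch_bounds:
  assumes "x \<in> {0..1}"
  shows "0 \<le> branch w x" "branch w x \<le> 1"
proof (induction w)
  case (Cons b w)
  { case 1 show ?case using Cons by (simp add: divide_simps) }
  { case 2 show ?case using Cons by simp }
qed (use assms in auto)

lemma branch_in: "x \<in> {0..1} \<Longrightarrow> branch w x \<in> {0..1}"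
  using branch_bounds[of x w] by simp

lemma branch_append: "branch (u @ v) x = branch u (branch v x)"
  by (induction u) auto

lemma denom_append: "denom (u @ v) x = denom u (branch v x) * denom v x"
  by (induction u) (auto simp: branch_append)

text \<open>This interval is used for tails: it avoids 0 and 1, where floors would return wrong
  digits, and its width 1/2 keeps neighbouring digits apart in the lower bound.\<close>

lemma branch_Cons_gt_half:
  assumes "x \<in> {0..1}" "1 \<le> b"
  shows "branch (b # w) x \<in> {1/2..<1}"
proof -
  have "0 \<le> branch w x" using branch_bounds assms by blast
  then show ?thesis using assms by (auto simp: divide_simps)
qed

lemma branch_in_half:
  assumes "z \<in> {1/2..<1}" "\<forall>b\<in>set w. 1 \<le> b"
  shows "branch w z \<in> {1/2..<1}"
proof (cases w)
  case (Cons b v)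
  then show ?thesis using branch_Cons_gt_half[of z b v] assms by (simp del: branch.simps)
qed (use assms in simp)

lemma denom_ge_1:
  assumes "x \<in> {0..1}"
  shows "1 \<le> denom w x"
proof (induction w)
  case (Cons b w)
  have "1 \<le> real b + 1 + branch w x" using branch_bounds[OF assms, of w] by simp
  with Cons have "1 * 1 \<le> (real b + 1 + branch w x) * denom w x" by (intro mult_mono) auto
  then show ?case by simp
qed simp

lemma denom_pos: "x \<in> {0..1} \<Longrightarrow> 0 < denom w x"
  using denom_ge_1[of x w] by linarith

text \<open>Each letter acts by a Moebius map of determinant 1, so the identity is exact at finite
  distance and yields both upper and lower distortion bounds.\<close>

lemma branch_diff:
  assumes "x \<in> {0..1}" "y \<in> {0..1}"
  shows "branch w x - branch w y = (x - y) / (denom w x * denom w y)"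
proof (induction w)
  case (Cons b w)
  let ?u = "real b + 1 + branch w x" and ?v = "real b + 1 + branch w y"
  have pos: "?u > 0" "?v > 0"
    using branch_bounds[OF assms(1), of w] branch_bounds[OF assms(2), of w] by simp_all
  have "branch (b # w) x - branch (b # w) y = (?u - ?v) / (?u * ?v)"
    using pos by (simp add: diff_frac_eq mult.commute)
  also have "?u - ?v = (x - y) / (denom w x * denom w y)" using Cons by simp
  finally show ?case by (simp add: field_simps)
qed simp

lemma branch_mono:
  assumes "x \<in> {0..1}" "y \<in> {0..1}" "x \<le> y"
  shows "branch w x \<le> branch w y"
proof -
  have "0 \<le> branch w y - branch w x"
    using assms denom_pos[of x w] denom_pos[of y w] by (simp add: branch_diff)
  then show ?thesis by simp
qed

definition pos_words :: "nat \<Rightarrow> nat list set" where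
  "pos_words n = {w. length w = n \<and> (\<forall>b\<in>set w. 1 \<le> b)}"

text \<open>Letters are appended on the right because the denominator b + 1 + x of the new argument
  is exactly the new factor and cancels. The coefficients constructed are p = q_(2n-1) and q = q_2n;
  p \<le> q gives bounded distortion.\<close>

lemma denom_affine:
  assumes "\<forall>b\<in>set w. 1 \<le> b"
  shows "\<exists>p q. 0 \<le> p \<and> p \<le> q \<and> (\<forall>x\<in>{0..1}. denom w x = p * x + q)"
  using assms
proof (induction w rule: rev_induct)
  case Nil
  show ?case by (rule exI[of _ 0], rule exI[of _ 1]) simp
next
  case (snoc b w)
  then obtain p q where pq: "0 \<le> p" "p \<le> q" "\<And>x. x \<in> {0..1} \<Longrightarrow> denom w x = p * x + q"
    by auto
  have "denom (w @ [b]) x = (p + q) * x + (p * b + q * (b + 1))" if "x \<in> {0..1}" for x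
  proof -
    have "branch [b] x \<in> {0..1}" by (rule branch_in[OF that])
    then have "denom (w @ [b]) x = (p * branch [b] x + q) * (real b + 1 + x)"
      by (simp add: denom_append pq del: branch.simps) simp
    also have "\<dots> = (p + q) * x + (p * b + q * (b + 1))"
      using that by (simp add: field_simps)
    finally show ?thesis .
  qed
  moreover have "p * 1 \<le> p * b" "q * 1 \<le> q * (b + 1)"
    using pq snoc.prems by (intro mult_left_mono; simp)+
  ultimately show ?case using pq
    by (intro exI[of _ "p + q"] exI[of _ "p * b + q * (b + 1)"]) auto
qed

lemma denom_mono:
  assumes "x \<in> {0..1}" "y \<in> {0..1}" "x \<le> y"
  shows "denom w x \<le> denom w y"
proof (induction w)
  case (Cons b w)
  then show ?case
    using branch_mono[OF assms, of w] branch_bounds[OF assms(1), of w]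
      denom_pos[OF assms(1), of w] by (auto intro!: mult_mono)
qed simp

lemma denom_le_double:
  assumes "\<forall>b\<in>set w. 1 \<le> b" "x \<in> {0..1}"
  shows "denom w x \<le> 2 * denom w 0"
proof -
  obtain p q where pq: "0 \<le> p" "p \<le> q" "\<And>x. x \<in> {0..1} \<Longrightarrow> denom w x = p * x + q"
    using denom_affine[OF assms(1)] by blast
  have "p * x \<le> q * 1" using pq assms by (intro mult_mono) auto
  then show ?thesis using pq assms by simp
qed

text \<open>The coefficient of x equals q_(2n-1), because odd digits are 1. Writing it as a
  difference also covers n = 0, where q_-1 is not a value of \<open>cf_denom\<close>.\<close>

lemma cf_denom_interleave_ones:
  assumes "x \<in> {0..1}"
  defines "q \<equiv> \<lambda>b k. real (cf_denom (interleave_ones b) k)"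
  shows "denom (map b [1..<Suc n]) x = q b (2 * n) + x * (q b (2 * n + 1) - q b (2 * n))"
  using assms(1)
proof (induction n arbitrary: x)
  case 0
  then show ?case by (simp add: q_def interleave_ones_def)
next
  case (Suc n)
  define y where "y = branch [b (Suc n)] x"
  have y: "y \<in> {0..1}" unfolding y_def by (rule branch_in[OF Suc.prems])
  have odd: "q b (Suc (Suc (Suc (2 * n)))) = q b (Suc (Suc (2 * n))) + q b (Suc (2 * n))"
    and even: "q b (Suc (Suc (2 * n))) = b (Suc n) * q b (Suc (2 * n)) + q b (2 * n)"
    by (simp_all add: q_def interleave_ones_def)
  have pos: "x + 1 + real (b (Suc n)) > 0" using Suc.prems by simp
  have "denom (map b [1..<Suc (Suc n)]) x
      = denom (map b [1..<Suc n]) y * (real (b (Suc n)) + 1 + x)"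
    by (simp add: denom_append y_def)
  also have "\<dots> = q b (2 * n) * (real (b (Suc n)) + 1 + x)
      + (y * (real (b (Suc n)) + 1 + x)) * (q b (Suc (2 * n)) - q b (2 * n))"
    by (subst Suc.IH[OF y]) (simp add: algebra_simps)
  also have "y * (real (b (Suc n)) + 1 + x) = real (b (Suc n)) + x"
    using pos by (simp add: y_def field_simps)
  also have "q b (2 * n) * (real (b (Suc n)) + 1 + x) + (real (b (Suc n)) + x) * (q b (Suc (2 * n)) - q b (2 * n))
      = q b (2 * Suc n) + x * (q b (2 * Suc n + 1) - q b (2 * Suc n))"
    by (simp add: odd even) (simp add: algebra_simps)
  finally show ?case .
qed

lemma cf_denom_eq_denom: "real (cf_denom (interleave_ones b) (2 * n)) = denom (map b [1..<Suc n]) 0"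
  using cf_denom_interleave_ones[of 0 b n] by simp

section \<open>Digits of branch images and of points in \<open>I_even\<close>\<close>

lemma gauss_map_branch_Cons:
  assumes "z \<in> {0<..<1}" "1 \<le> b"
  defines "y \<equiv> branch [b] z"
  shows "\<lfloor>1 / y\<rfloor> = 1" "\<lfloor>1 / gauss_map y\<rfloor> = int b" "gauss_map (gauss_map y) = z"
proof -
  have y: "y = (real b + z) / (real b + 1 + z)" using assms by (simp add: y_def field_simps)
  have inv: "1 / y = 1 + 1 / (real b + z)" using assms by (simp add: y field_simps)
  \<comment> \<open>Both endpoints are excluded: z > 0 keeps 1 / (b + z) below 1 when b = 1, and z <
    1 makes the floor of b + z equal to b.\<close>
  have lt: "0 < 1 / (real b + z)" "1 / (real b + z) < 1" using assms by (simp_all add: field_simps)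
  show 1: "\<lfloor>1 / y\<rfloor> = 1" unfolding inv using lt by (simp add: floor_eq_iff)
  have "y \<noteq> 0" using y assms by auto
  then have g: "gauss_map y = 1 / (real b + z)"
    using 1 inv by (simp add: gauss_map_def frac_def)
  show 2: "\<lfloor>1 / gauss_map y\<rfloor> = int b" unfolding g using assms by (simp add: floor_eq_iff)
  show "gauss_map (gauss_map y) = z"
    using 2 g lt unfolding gauss_map_def[of "gauss_map y"] frac_def by simp
qed

lemma funpow_gauss_map_branch:
  assumes "z \<in> {1/2..<1}" "\<forall>b\<in>set w. 1 \<le> b" "k \<le> length w"
  shows "(gauss_map ^^ (2 * k)) (branch w z) = branch (drop k w) z"
  using assms(2,3)
proof (induction k arbitrary: w)
  case (Suc k)
  then obtain b v where w: "w = b # v" by (cases w) auto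
  have "branch v z \<in> {1/2..<1}" using branch_in_half[OF assms(1)] Suc.prems w by simp
  then have "gauss_map (gauss_map (branch w z)) = branch v z"
    using gauss_map_branch_Cons(3)[of "branch v z" b] Suc.prems w by simp
  moreover have "(gauss_map ^^ (2 * Suc k)) (branch w z)
      = (gauss_map ^^ (2 * k)) (gauss_map (gauss_map (branch w z)))"
    by (metis (no_types, lifting) add_2_eq_Suc' comp_apply funpow_Suc_right mult_Suc_right add.commute)
  ultimately show ?case using Suc w by simp
qed simp

lemma partial_quotient_branch:
  assumes "z \<in> {1/2..<1}" "\<forall>b\<in>set w. 1 \<le> b" "k < length w"
  shows "partial_quotient (branch w z) (2 * k + 1) = 1"
    and "partial_quotient (branch w z) (2 * Suc k) = w ! k"
proof -
  have drop: "drop k w = w ! k # drop (Suc k) w" using assms(3) by (simp add: Cons_nth_drop_Suc)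
  define y where "y = branch (drop (Suc k) w) z"
  have y: "y \<in> {0<..<1}"
  proof -
    have "y \<in> {1/2..<1}" unfolding y_def
      by (rule branch_in_half[OF assms(1)]) (meson assms(2) in_set_dropD)
    then show ?thesis by auto
  qed
  have b: "1 \<le> w ! k" using assms by simp
  have iter: "(gauss_map ^^ (2 * k)) (branch w z) = branch [w ! k] y"
    using funpow_gauss_map_branch[OF assms(1,2), of k] assms(3) drop by (simp add: y_def)
  show "partial_quotient (branch w z) (2 * k + 1) = 1"
    using gauss_map_branch_Cons(1)[OF y b] iter by (simp add: partial_quotient_def)
  have "(gauss_map ^^ (2 * Suc k - 1)) (branch w z) = gauss_map (branch [w ! k] y)"
    using iter by simp
  then show "partial_quotient (branch w z) (2 * Suc k) = w ! k"
    using gauss_map_branch_Cons(2)[OF y b] by (simp add: partial_quotient_def)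
qed

text \<open>A first digit 1 forces 1 \<le> 1 / x < 2; in particular x is not 0, for which 1 / 0 = 0
  would give the digit 0. Then x < 1 makes the next iterate positive, so both Gauss steps can be
  inverted.\<close>

lemma I_even_step:
  assumes "x \<in> I_even"
  shows "gauss_map (gauss_map x) \<in> I_even" "1 \<le> partial_quotient x 2"
    and "x = branch [partial_quotient x 2] (gauss_map (gauss_map x))"
proof -
  have x: "0 \<le> x" "x < 1" and pq: "\<And>k. partial_quotient x (2 * k + 1) = 1"
    using assms by (auto simp: I_even_def)
  have fl: "\<lfloor>1 / x\<rfloor> = 1" using pq[of 0] by (simp add: partial_quotient_def)
  then have "x \<noteq> 0" by auto
  with x have x0: "0 < x" by simp
  define g where "g = gauss_map x"
  have g: "g = 1 / x - 1" using x0 fl by (simp add: g_def gauss_map_def frac_def)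
  have g0: "0 < g" using x0 x by (simp add: g)
  have g1: "g < 1" using fl unfolding g by linarith
  have "1 \<le> 1 / g" using g0 g1 by simp
  then have b: "1 \<le> \<lfloor>1 / g\<rfloor>" by linarith
  have pq2: "partial_quotient x 2 = nat \<lfloor>1 / g\<rfloor>" by (simp add: partial_quotient_def g_def)
  show "1 \<le> partial_quotient x 2" using b pq2 by linarith
  have gg: "gauss_map g = 1 / g - \<lfloor>1 / g\<rfloor>" using g0 by (simp add: gauss_map_def frac_def)
  have "real (partial_quotient x 2) + gauss_map g = 1 / g"
    using b gg unfolding pq2 by linarith
  then have "branch [partial_quotient x 2] (gauss_map g) = 1 - 1 / (1 / g + 1)"
    by (simp add: algebra_simps)
  also have "\<dots> = x" using x0 g0 by (simp add: g field_simps)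
  finally show "x = branch [partial_quotient x 2] (gauss_map (gauss_map x))" by (simp add: g_def)
  have "gauss_map g \<in> {0..<1}" by (simp add: gauss_map_def frac_lt_1)
  moreover have "partial_quotient (gauss_map g) (2 * k + 1) = 1" for k
  proof -
    have "(gauss_map ^^ (2 * Suc k)) x = (gauss_map ^^ (2 * k)) (gauss_map (gauss_map x))"
      by (metis (no_types, lifting) add_2_eq_Suc' comp_apply funpow_Suc_right mult_Suc_right add.commute)
    then show ?thesis using pq[of "Suc k"] by (simp add: partial_quotient_def g_def)
  qed
  ultimately show "gauss_map (gauss_map x) \<in> I_even" by (simp add: I_even_def g_def)
qed

lemma I_even_expansion:
  assumes "x \<in> I_even"
  shows "\<exists>w\<in>pos_words n. \<exists>z\<in>I_even. x = branch w z \<and> partial_quotient z 2 = partial_quotient x (2 * Suc n)"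
  using assms
proof (induction n arbitrary: x)
  case 0
  then show ?case by (auto simp: pos_words_def intro!: bexI[of _ x])
next
  case (Suc n)
  note st = I_even_step[OF Suc.prems]
  define y where "y = gauss_map (gauss_map x)"
  obtain w z where w: "w \<in> pos_words n" "z \<in> I_even" "y = branch w z"
    "partial_quotient z 2 = partial_quotient y (2 * Suc n)"
    using Suc.IH st(1) unfolding y_def by blast
  have "(gauss_map ^^ (2 * Suc (Suc n) - 1)) x = (gauss_map ^^ (2 * Suc n - 1)) y"
    unfolding y_def
    by (simp add: funpow_swap1)
  then have "partial_quotient y (2 * Suc n) = partial_quotient x (2 * Suc (Suc n))"
    by (simp add: partial_quotient_def)
  then show ?case using w st(2,3)
    by (intro bexI[of _ "partial_quotient x 2 # w"] bexI[of _ z])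
      (auto simp: pos_words_def y_def)
qed

section \<open>Bounds for Hausdorff measures\<close>

lemma powr_le_diam_powr:
  assumes "bounded U" "U \<noteq> {}" "diameter U \<le> 1" "0 \<le> s'" "s' \<le> s"
  shows "ennreal (diameter U powr s) \<le> diam_powr s' U"
proof -
  have "0 \<le> diameter U" using assms(1) by (rule diameter_ge_0)
  then have "diameter U powr s \<le> (if s' = 0 then 1 else diameter U powr s')"
    using assms by (auto intro: powr_le1 powr_mono')
  then show ?thesis using assms by (auto simp: diam_powr_def ennreal_le_1 intro!: ennreal_leI)
qed

text \<open>A mass distribution principle whose mass is Lebesgue measure of the parameter. No
  measurability of X is assumed, so each {t. X t \<in> U i} is enclosed in an interval centred at
  one of its points, of length 2 C diam^s.\<close>

lemma hausdorff_measure_pos_of_expanding_param: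
  fixes X :: "real \<Rightarrow> 'a::metric_space"
  assumes X: "\<And>t. t \<in> {0..<1} \<Longrightarrow> X t \<in> F"
    and expand: "\<And>t t'. t \<in> {0..<1} \<Longrightarrow> t' \<in> {0..<1} \<Longrightarrow> \<bar>t - t'\<bar> \<le> C * dist (X t) (X t') powr s"
    and "0 < C" "0 \<le> s'" "s' \<le> s"
  shows "hausdorff_measure s' F \<noteq> 0"
proof -
  have cover: "1 \<le> ennreal (2 * C) * (\<Sum>i. diam_powr s' (U i))"
    if U: "F \<subseteq> (\<Union>i. U i)" "\<And>i. bounded (U i)" "\<And>i. diameter (U i) \<le> 1" for U :: "nat \<Rightarrow> 'a set"
  proof -
    have "\<exists>I. I \<in> sets lborel \<and> {t \<in> {0..<1}. X t \<in> U i} \<subseteq> I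
        \<and> emeasure lborel I \<le> ennreal (2 * C) * diam_powr s' (U i)" for i
    proof (cases "{t \<in> {0..<1}. X t \<in> U i} = {}")
      case True
      then show ?thesis by (intro exI[of _ "{}"]) auto
    next
      case False
      then obtain t where t: "t \<in> {0..<1}" "X t \<in> U i" by blast
      define d where "d = C * diameter (U i) powr s"
      have d0: "0 \<le> d" using \<open>0 < C\<close> by (simp add: d_def)
      have "\<bar>t' - t\<bar> \<le> d" if "t' \<in> {0..<1}" "X t' \<in> U i" for t'
      proof -
        have "dist (X t') (X t) \<le> diameter (U i)"
          using diameter_bounded_bound[OF U(2) that(2) t(2)] .
        then have "dist (X t') (X t) powr s \<le> diameter (U i) powr s"
          using assms by (intro powr_mono2) auto
        then have "C * dist (X t') (X t) powr s \<le> d" unfolding d_def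
          using \<open>0 < C\<close> by (intro mult_left_mono) auto
        then show ?thesis using expand[OF that(1) t(1)] by linarith
      qed
      then have "{t \<in> {0..<1}. X t \<in> U i} \<subseteq> {t - d..t + d}" by (fastforce simp: abs_le_iff)
      moreover have "emeasure lborel {t - d..t + d} \<le> ennreal (2 * C) * diam_powr s' (U i)"
      proof -
        have "emeasure lborel {t - d..t + d} = ennreal (2 * d)" using d0 by simp
        also have "\<dots> = ennreal (2 * C) * ennreal (diameter (U i) powr s)"
          unfolding d_def using \<open>0 < C\<close> by (simp add: ennreal_mult[symmetric] mult.assoc)
        also have "\<dots> \<le> ennreal (2 * C) * diam_powr s' (U i)"
          using U t assms by (intro mult_left_mono powr_le_diam_powr) auto
        finally show ?thesis .
      qed
      ultimately show ?thesis by (intro exI[of _ "{t - d..t + d}"]) auto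
    qed
    then obtain I where I: "\<And>i. I i \<in> sets lborel" "\<And>i. {t \<in> {0..<1}. X t \<in> U i} \<subseteq> I i"
      "\<And>i. emeasure lborel (I i) \<le> ennreal (2 * C) * diam_powr s' (U i)" by metis
    have "{0..<1} \<subseteq> (\<Union>i. I i)" using X U(1) I(2) by blast
    then have "emeasure lborel {0..<1::real} \<le> emeasure lborel (\<Union>i. I i)"
      using I(1) by (intro emeasure_mono) auto
    also have "\<dots> \<le> (\<Sum>i. emeasure lborel (I i))"
      using I(1) by (intro emeasure_subadditive_countably) auto
    also have "\<dots> \<le> (\<Sum>i. ennreal (2 * C) * diam_powr s' (U i))"
      using I(3) by (intro suminf_le) auto
    also have "\<dots> = ennreal (2 * C) * (\<Sum>i. diam_powr s' (U i))" by simp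
    finally show ?thesis by simp
  qed
  \<comment> \<open>One scale suffices because the measure is a supremum over scales; scale 1 keeps
    diameters at most 1, which allows passing from s to s'.\<close>
  have "ennreal (1 / (2 * C)) \<le> hausdorff_premeasure s' 1 F"
    unfolding hausdorff_premeasure_def
  proof (rule INF_greatest, clarify)
    fix U :: "nat \<Rightarrow> 'a set"
    assume "F \<subseteq> (\<Union>i. U i)" "\<forall>i. bounded (U i) \<and> diameter (U i) \<le> 1"
    then have "1 \<le> ennreal (2 * C) * (\<Sum>i. diam_powr s' (U i))" using cover by blast
    then have "ennreal (1 / (2 * C)) * 1 \<le> ennreal (1 / (2 * C)) * (ennreal (2 * C) * (\<Sum>i. diam_powr s' (U i)))"
      by (intro mult_left_mono) auto
    also have "\<dots> = ennreal (1 / (2 * C) * (2 * C)) * (\<Sum>i. diam_powr s' (U i))"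
      using \<open>0 < C\<close> by (subst ennreal_mult) (auto simp: mult.assoc)
    finally show "ennreal (1 / (2 * C)) \<le> (\<Sum>i. diam_powr s' (U i))" using \<open>0 < C\<close> by simp
  qed
  also have "\<dots> \<le> hausdorff_measure s' F"
    unfolding hausdorff_measure_def by (rule SUP_upper) simp
  finally have "ennreal (1 / (2 * C)) \<le> hausdorff_measure s' F" .
  moreover have "0 < ennreal (1 / (2 * C))" using \<open>0 < C\<close> by simp
  ultimately show ?thesis by (metis leD)
qed

text \<open>A family indexed by words becomes a sequence through \<open>to_nat\<close>; indices that
  code no member of A receive the empty set, which costs 0. Phrasing \<open>sums\<close> with finite
  subfamilies lets level bounds be applied directly.\<close>

lemma hausdorff_premeasure_le_countable_cover:
  fixes U :: "'i::countable \<Rightarrow> 'a::metric_space set"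
  assumes "F \<subseteq> (\<Union>w\<in>A. U w)" and "0 \<le> \<delta>"
    and "\<And>w. w \<in> A \<Longrightarrow> bounded (U w) \<and> diameter (U w) \<le> \<delta>"
    and sums: "\<And>S. finite S \<Longrightarrow> S \<subseteq> A \<Longrightarrow> (\<Sum>w\<in>S. diam_powr s (U w)) \<le> c"
  shows "hausdorff_premeasure s \<delta> F \<le> c"
proof -
  define V where "V i = (if i \<in> to_nat ` A then U (from_nat i) else {})" for i
  have "F \<subseteq> (\<Union>i. V i)"
  proof
    fix x assume "x \<in> F"
    then obtain w where "w \<in> A" "x \<in> U w" using assms(1) by blast
    then show "x \<in> (\<Union>i. V i)" by (intro UN_I[of "to_nat w"]) (auto simp: V_def)
  qed
  moreover have "bounded (V i) \<and> diameter (V i) \<le> \<delta>" for i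
    using assms(2,3) by (auto simp: V_def)
  ultimately have "hausdorff_premeasure s \<delta> F \<le> (\<Sum>i. diam_powr s (V i))"
    unfolding hausdorff_premeasure_def by (intro INF_lower) auto
  also have "\<dots> \<le> c"
  proof (rule suminf_le_const[OF summableI])
    fix n
    let ?T = "{w \<in> A. to_nat w < n}"
    have fin: "finite ?T"
      by (rule finite_imageD[of to_nat]) (auto intro: finite_subset[of _ "{..<n}"] inj_on_subset[OF inj_to_nat])
    have "(\<Sum>i<n. diam_powr s (V i)) = (\<Sum>i\<in>to_nat ` ?T. diam_powr s (V i))"
      by (rule sum.mono_neutral_right) (auto simp: V_def diam_powr_def)
    also have "\<dots> = (\<Sum>w\<in>?T. diam_powr s (U w))"
      by (subst sum.reindex) (auto simp: V_def inj_on_subset[OF inj_to_nat])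
    also have "\<dots> \<le> c" using fin by (intro sums) auto
    finally show "(\<Sum>i<n. diam_powr s (V i)) \<le> c" .
  qed
  finally show ?thesis .
qed

lemma hausdorff_measure_eq_0I:
  assumes "\<And>\<delta> \<epsilon>. 0 < \<delta> \<Longrightarrow> 0 < \<epsilon> \<Longrightarrow> hausdorff_premeasure s \<delta> F \<le> ennreal \<epsilon>"
  shows "hausdorff_measure s F = 0"
proof -
  have "hausdorff_premeasure s \<delta> F \<le> 0" if "\<delta> > 0" for \<delta>
    by (rule ennreal_le_epsilon) (use assms[OF that] in auto)
  then have "hausdorff_measure s F \<le> 0"
    unfolding hausdorff_measure_def by (intro SUP_least) auto
  then show ?thesis by simp
qed

section \<open>Level sums and the critical exponent\<close>

definition word_weight :: "real \<Rightarrow> nat list \<Rightarrow> real" where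
  "word_weight B w = B ^ (2 * length w) * (denom w 0)\<^sup>2"

text \<open>Bounds the whole infinite sum through its finite partial sums, so that no question of
  convergence arises; for c = 1 this is the condition defining \<open>s_level\<close>.\<close>

definition level_sum_le :: "real \<Rightarrow> nat \<Rightarrow> real \<Rightarrow> real \<Rightarrow> bool" where
  "level_sum_le B n \<rho> c \<longleftrightarrow>
    (\<forall>S. finite S \<longrightarrow> S \<subseteq> pos_words n \<longrightarrow> (\<Sum>w\<in>S. word_weight B w powr - \<rho>) \<le> c)"

lemma level_sum_leD:
  "level_sum_le B n \<rho> c \<Longrightarrow> finite S \<Longrightarrow> S \<subseteq> pos_words n \<Longrightarrow> (\<Sum>w\<in>S. word_weight B w powr - \<rho>) \<le> c"
  by (simp add: level_sum_le_def)

lemma level_sum_le_nonneg: "level_sum_le B n \<rho> c \<Longrightarrow> 0 \<le> c"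
  using level_sum_leD[of B n \<rho> c "{}"] by simp

lemma bij_betw_digits_pos_words:
  "bij_betw (\<lambda>b. map b [1..<Suc n]) ({1..n} \<rightarrow>\<^sub>E {1..}) (pos_words n)"
proof (rule bij_betw_byWitness[where f' = "\<lambda>w. restrict (\<lambda>k. w ! (k - 1)) {1..n}"])
  show "\<forall>b\<in>{1..n} \<rightarrow>\<^sub>E {1..}. restrict (\<lambda>k. map b [1..<Suc n] ! (k - 1)) {1..n} = b"
    by (auto simp: fun_eq_iff restrict_def PiE_def extensional_def simp del: upt_Suc)
  show "\<forall>w\<in>pos_words n. map (restrict (\<lambda>k. w ! (k - 1)) {1..n}) [1..<Suc n] = w"
    by (auto simp: pos_words_def list_eq_iff_nth_eq simp del: upt_Suc)
  show "(\<lambda>b. map b [1..<Suc n]) ` ({1..n} \<rightarrow>\<^sub>E {1..}) \<subseteq> pos_words n"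
    by (auto simp: pos_words_def PiE_def Pi_iff simp del: upt_Suc)
  show "(\<lambda>w. restrict (\<lambda>k. w ! (k - 1)) {1..n}) ` pos_words n \<subseteq> {1..n} \<rightarrow>\<^sub>E {1..}"
    by (auto simp: pos_words_def)
qed

lemma s_level_sum_le_iff:
  assumes "1 < B"
  shows "s_level_sum B n \<rho> \<le> 1 \<longleftrightarrow> level_sum_le B n \<rho> 1"
proof -
  let ?g = "\<lambda>w. ennreal (word_weight B w powr - \<rho>)"
  have "s_level_sum B n \<rho> = (\<Sum>\<^sub>\<infinity>b \<in> {1..n} \<rightarrow>\<^sub>E {1..}. ?g (map b [1..<Suc n]))"
    unfolding s_level_sum_def
    by (intro infsum_cong)
      (simp add: word_weight_def cf_denom_eq_denom powr_minus_divide powr_divide assms less_imp_le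
        del: upt_Suc)
  also have "\<dots> = infsum ?g (pos_words n)"
    by (rule infsum_reindex_bij_betw[OF bij_betw_digits_pos_words])
  also have "\<dots> = (SUP S\<in>{S. finite S \<and> S \<subseteq> pos_words n}. sum ?g S)"
    by (rule nonneg_infsum_complete) simp
  also have "\<dots> \<le> 1 \<longleftrightarrow> (\<forall>S. finite S \<longrightarrow> S \<subseteq> pos_words n \<longrightarrow> sum ?g S \<le> 1)"
    by (auto simp: SUP_le_iff)
  also have "\<dots> \<longleftrightarrow> level_sum_le B n \<rho> 1" unfolding level_sum_le_def by simp
  finally show ?thesis .
qed

lemma word_weight_ge_1:
  assumes "1 < B"
  shows "B ^ (2 * length w) \<le> word_weight B w" "1 \<le> word_weight B w"
proof -
  have "1 \<le> (denom w 0)\<^sup>2" by (simp add: denom_ge_1)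
  then have "B ^ (2 * length w) * 1 \<le> B ^ (2 * length w) * (denom w 0)\<^sup>2"
    using assms by (intro mult_left_mono) auto
  then show "B ^ (2 * length w) \<le> word_weight B w" by (simp add: word_weight_def)
  moreover have "1 \<le> B ^ (2 * length w)" using assms by simp
  ultimately show "1 \<le> word_weight B w" by linarith
qed

text \<open>In the denominator of u @ v the factor \<open>denom u\<close> is evaluated at
  \<open>branch v 0\<close>, which is at least 0, and \<open>denom u\<close> is increasing.\<close>

lemma word_weight_append_ge:
  assumes "1 < B"
  shows "word_weight B u * word_weight B v \<le> word_weight B (u @ v)"
proof -
  have "denom u 0 * denom v 0 \<le> denom (u @ v) 0"
    using denom_mono[of 0 "branch v 0" u] branch_in[of 0 v] denom_ge_1[of 0 v]
    unfolding denom_append by (intro mult_right_mono) auto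
  then have "(denom u 0 * denom v 0)\<^sup>2 \<le> (denom (u @ v) 0)\<^sup>2"
    using denom_ge_1[of 0 u] denom_ge_1[of 0 v] by (intro power_mono) auto
  then have "B ^ (2 * length (u @ v)) * (denom u 0 * denom v 0)\<^sup>2 \<le> word_weight B (u @ v)"
    unfolding word_weight_def using assms by (intro mult_left_mono) auto
  then show ?thesis by (simp add: word_weight_def power_add power_mult_distrib algebra_simps)
qed

text \<open>Cutting words after a letters is injective, so the sum is dominated by a product of two
  sums; the negative exponent turns supermultiplicative weights into submultiplicative sums.\<close>

lemma level_sum_le_add:
  assumes "1 < B" "0 \<le> \<rho>" and a: "level_sum_le B a \<rho> c" and b: "level_sum_le B b \<rho> d"
  shows "level_sum_le B (a + b) \<rho> (c * d)"
  unfolding level_sum_le_def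
proof (intro allI impI)
  fix S assume S: "finite S" "S \<subseteq> pos_words (a + b)"
  let ?g = "\<lambda>w. word_weight B w powr - \<rho>"
  have take: "take a ` S \<subseteq> pos_words a" and drop: "drop a ` S \<subseteq> pos_words b"
    using S(2) by (auto simp: pos_words_def dest: in_set_takeD in_set_dropD)
  have inj: "inj_on (\<lambda>w. (take a w, drop a w)) S"
    by (rule inj_onI) (metis append_take_drop_id prod.inject)
  have "(\<Sum>w\<in>S. ?g w) \<le> (\<Sum>w\<in>S. ?g (take a w) * ?g (drop a w))"
  proof (rule sum_mono)
    fix w assume "w \<in> S"
    have pos: "0 < word_weight B (take a w)" "0 < word_weight B (drop a w)"
      using word_weight_ge_1(2)[OF assms(1), of "take a w"] word_weight_ge_1(2)[OF assms(1), of "drop a w"]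
      by linarith+
    have "?g w \<le> (word_weight B (take a w) * word_weight B (drop a w)) powr - \<rho>"
      using word_weight_append_ge[OF assms(1), of "take a w" "drop a w"] pos assms(2)
      by (intro powr_mono2') auto
    then show "?g w \<le> ?g (take a w) * ?g (drop a w)" using pos by (simp add: powr_mult)
  qed
  also have "\<dots> = (\<Sum>(u, v)\<in>(\<lambda>w. (take a w, drop a w)) ` S. ?g u * ?g v)"
    by (subst sum.reindex[OF inj]) simp
  also have "\<dots> \<le> (\<Sum>(u, v)\<in>take a ` S \<times> drop a ` S. ?g u * ?g v)"
    using S(1) by (intro sum_mono2) auto
  also have "\<dots> = (\<Sum>u\<in>take a ` S. ?g u) * (\<Sum>v\<in>drop a ` S. ?g v)"
    by (simp add: sum_product sum.cartesian_product)
  also have "\<dots> \<le> c * d"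
    using level_sum_leD[OF a _ take] level_sum_leD[OF b _ drop] S(1) level_sum_le_nonneg[OF a]
    by (intro mult_mono) (auto intro: sum_nonneg)
  finally show "(\<Sum>w\<in>S. ?g w) \<le> c * d" .
qed

lemma level_sum_le_0: "level_sum_le B 0 \<rho> 1"
proof -
  have "(\<Sum>w\<in>S. word_weight B w powr - \<rho>) \<le> (\<Sum>w\<in>{[]}. word_weight B w powr - \<rho>)"
    if "S \<subseteq> {[]}" for S
    using that by (intro sum_mono2) auto
  then show ?thesis by (auto simp: level_sum_le_def pos_words_def word_weight_def)
qed

lemma level_sum_le_mult:
  assumes "1 < B" "0 \<le> \<rho>" "level_sum_le B n \<rho> 1"
  shows "level_sum_le B (k * n) \<rho> 1"
proof (induction k)
  case (Suc k)
  then show ?case using level_sum_le_add[OF assms Suc] by simp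
qed (simp add: level_sum_le_0)

text \<open>Appending the digit 1 compares a level with the next one, to reach lengths between
  multiples of a good level. The factor is 16 = 4^2: \<open>denom [1] 0\<close> is 2, and evaluating
  \<open>denom w\<close> at 1/2 instead of 0 costs at most another 2.\<close>

lemma level_sum_le_Suc:
  assumes "1 < B" "0 \<le> \<rho>" "level_sum_le B (Suc n) \<rho> c"
  shows "level_sum_le B n \<rho> ((16 * B\<^sup>2) powr \<rho> * c)"
  unfolding level_sum_le_def
proof (intro allI impI)
  fix S assume S: "finite S" "S \<subseteq> pos_words n"
  let ?app = "\<lambda>w. w @ [1]"
  have inj: "inj_on ?app S" by (rule inj_onI) simp
  have "(\<Sum>w\<in>S. word_weight B w powr - \<rho>)
      \<le> (\<Sum>w\<in>S. (16 * B\<^sup>2) powr \<rho> * word_weight B (?app w) powr - \<rho>)"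
  proof (rule sum_mono)
    fix w assume "w \<in> S"
    then have w: "\<forall>b\<in>set w. 1 \<le> b" using S by (auto simp: pos_words_def)
    have "denom w (1 / 2) \<le> 2 * denom w 0" by (rule denom_le_double[OF w]) auto
    then have "denom (?app w) 0 \<le> 4 * denom w 0" by (simp add: denom_append)
    then have "(denom (?app w) 0)\<^sup>2 \<le> (4 * denom w 0)\<^sup>2"
      using denom_ge_1[of 0 "?app w"] by (intro power_mono) auto
    then have "B ^ (2 * length (?app w)) * (denom (?app w) 0)\<^sup>2 \<le> B ^ (2 * length (?app w)) * (16 * (denom w 0)\<^sup>2)"
      using assms(1) by (intro mult_left_mono) (auto simp: power_mult_distrib)
    then have "word_weight B (?app w) \<le> (16 * B\<^sup>2) * word_weight B w"
      by (simp add: word_weight_def algebra_simps power2_eq_square)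
    then have "((16 * B\<^sup>2) * word_weight B w) powr - \<rho> \<le> word_weight B (?app w) powr - \<rho>"
      using assms(2) word_weight_ge_1(2)[OF assms(1), of "?app w"] by (intro powr_mono2') auto
    then have "(16 * B\<^sup>2) powr \<rho> * ((16 * B\<^sup>2) powr - \<rho> * word_weight B w powr - \<rho>)
        \<le> (16 * B\<^sup>2) powr \<rho> * word_weight B (?app w) powr - \<rho>"
      using word_weight_ge_1(2)[OF assms(1), of w] assms(1)
      by (intro mult_left_mono) (auto simp: powr_mult)
    then show "word_weight B w powr - \<rho> \<le> (16 * B\<^sup>2) powr \<rho> * word_weight B (?app w) powr - \<rho>"
      using assms(1) by (simp add: mult.assoc[symmetric] powr_add[symmetric])
  qed
  also have "\<dots> = (16 * B\<^sup>2) powr \<rho> * (\<Sum>w\<in>?app ` S. word_weight B w powr - \<rho>)"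
    by (subst sum.reindex[OF inj]) (simp add: sum_distrib_left)
  also have "\<dots> \<le> (16 * B\<^sup>2) powr \<rho> * c"
    using S by (intro mult_left_mono level_sum_leD[OF assms(3)]) (fastforce simp: pos_words_def)+
  finally show "(\<Sum>w\<in>S. word_weight B w powr - \<rho>) \<le> (16 * B\<^sup>2) powr \<rho> * c" .
qed

lemma level_sum_le_mono: "level_sum_le B n \<rho> c \<Longrightarrow> c \<le> d \<Longrightarrow> level_sum_le B n \<rho> d"
  unfolding level_sum_le_def by (meson order_trans)

lemma level_sum_le_bounded:
  assumes "1 < B" "0 \<le> \<rho>" "1 \<le> n" "level_sum_le B n \<rho> 1"
  shows "\<exists>C. \<forall>m. level_sum_le B m \<rho> C"
proof -
  define A where "A = (16 * B\<^sup>2) powr \<rho>"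
  have "1 \<le> 16 * B\<^sup>2" using assms(1) one_le_power[of B 2] by linarith
  then have A: "1 \<le> A" unfolding A_def using assms(2) by (rule ge_one_powr_ge_zero)
  have shift: "level_sum_le B m \<rho> (A ^ r)" if "level_sum_le B (m + r) \<rho> 1" for m r
    using that
  proof (induction r arbitrary: m)
    case (Suc r)
    then have "level_sum_le B (Suc m) \<rho> (A ^ r)" by simp
    from level_sum_le_Suc[OF assms(1,2) this] show ?case by (simp add: A_def)
  qed simp
  have "level_sum_le B m \<rho> (A ^ n)" for m
  proof -
    \<comment> \<open>This gives the first multiple of n above m, at most n steps away; each step
      down costs a factor A.\<close>
    define k where "k = Suc (m div n)"
    have eq: "m div n * n + m mod n = m" by simp
    have lt: "m mod n < n" using assms(3) by simp
    have "m + (k * n - m) = k * n" and "k * n - m \<le> n"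
      using eq lt unfolding k_def mult_Suc by linarith+
    then have "level_sum_le B m \<rho> (A ^ (k * n - m))" "A ^ (k * n - m) \<le> A ^ n"
      using shift[of m "k * n - m"] level_sum_le_mult[OF assms(1,2,4), of k] A
      by (auto intro: power_increasing)
    then show ?thesis by (rule level_sum_le_mono)
  qed
  then show ?thesis by blast
qed

text \<open>Every weight of level n is at least B^(2n), so raising the exponent from \<rho> to s
  gains B^(-2n(s - \<rho>)) in each term.\<close>

lemma level_sum_le_decay:
  assumes "1 < B" "\<rho> \<le> s" "level_sum_le B n \<rho> c"
  shows "level_sum_le B n s (c * (B powr (- 2 * (s - \<rho>))) ^ n)"
  unfolding level_sum_le_def
proof (intro allI impI)
  fix S assume S: "finite S" "S \<subseteq> pos_words n"
  let ?\<beta> = "(B powr (- 2 * (s - \<rho>))) ^ n"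
  have "(\<Sum>w\<in>S. word_weight B w powr - s) \<le> (\<Sum>w\<in>S. word_weight B w powr - \<rho> * ?\<beta>)"
  proof (rule sum_mono)
    fix w assume "w \<in> S"
    then have len: "length w = n" using S by (auto simp: pos_words_def)
    have "word_weight B w powr - (s - \<rho>) \<le> (B ^ (2 * n)) powr - (s - \<rho>)"
      using word_weight_ge_1(1)[OF assms(1), of w] len assms by (intro powr_mono2') auto
    also have "(B ^ (2 * n)) powr - (s - \<rho>) = ?\<beta>"
      using assms(1) by (simp add: powr_realpow[symmetric] powr_powr algebra_simps)
    finally have "word_weight B w powr - \<rho> * word_weight B w powr - (s - \<rho>) \<le> word_weight B w powr - \<rho> * ?\<beta>"
      by (intro mult_left_mono) auto
    then show "word_weight B w powr - s \<le> word_weight B w powr - \<rho> * ?\<beta>"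
      by (simp add: powr_add[symmetric])
  qed
  also have "\<dots> = (\<Sum>w\<in>S. word_weight B w powr - \<rho>) * ?\<beta>" by (simp add: sum_distrib_right)
  also have "\<dots> \<le> c * ?\<beta>" using level_sum_leD[OF assms(3) S] by (intro mult_right_mono) auto
  finally show "(\<Sum>w\<in>S. word_weight B w powr - s) \<le> c * ?\<beta>" .
qed

text \<open>A single letter b has weight B^2 (b + 1)^2, and the sum of 1 / (b + 1)^2 is dominated by
  the telescoping sum of 1 / (b (b + 1)). This makes the sets of admissible exponents nonempty and
  bounds the critical exponent by 1.\<close>

lemma level_sum_le_one:
  assumes "1 < B"
  shows "level_sum_le B n 1 1"
proof -
  have tel: "(\<Sum>b\<in>{1..m}. 1 / (real b + 1)\<^sup>2) \<le> 1 - 1 / (real m + 1)" for m :: nat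
  proof (induction m)
    case (Suc m)
    have "1 / (real m + 2)\<^sup>2 \<le> 1 / ((real m + 1) * (real m + 2))"
      by (intro divide_left_mono) (auto simp: power2_eq_square)
    also have "\<dots> = 1 / (real m + 1) - 1 / (real m + 2)" by (simp add: field_simps)
    finally show ?case using Suc by (simp add: add.commute)
  qed simp
  have "level_sum_le B 1 1 1"
    unfolding level_sum_le_def
  proof (intro allI impI)
    fix S assume S: "finite S" "S \<subseteq> pos_words 1"
    have sing: "w = [hd w] \<and> 1 \<le> hd w" if "w \<in> S" for w
      using S that by (cases w) (auto simp: pos_words_def)
    then have inj: "inj_on hd S" by (metis inj_onI)
    have fin: "finite (hd ` S)" using S by simp
    then obtain m where "\<forall>b\<in>hd ` S. b \<le> m" using finite_nat_set_iff_bounded_le by blast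
    then have m: "hd ` S \<subseteq> {1..m}" using sing by auto
    have "(\<Sum>w\<in>S. word_weight B w powr - 1) \<le> (\<Sum>w\<in>S. 1 / (real (hd w) + 1)\<^sup>2)"
    proof (rule sum_mono)
      fix w assume "w \<in> S"
      then obtain b where w: "w = [b]" using sing by metis
      have "1 * (real b + 1)\<^sup>2 \<le> B\<^sup>2 * (real b + 1)\<^sup>2" using assms by (intro mult_right_mono) auto
      then have "1 / (B\<^sup>2 * (real b + 1)\<^sup>2) \<le> 1 / (real b + 1)\<^sup>2"
        using assms by (intro divide_left_mono mult_pos_pos) auto
      then show "word_weight B w powr - 1 \<le> 1 / (real (hd w) + 1)\<^sup>2"
        using word_weight_ge_1(2)[OF assms, of w] by (simp add: powr_minus_divide w word_weight_def)
    qed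
    also have "\<dots> = (\<Sum>b\<in>hd ` S. 1 / (real b + 1)\<^sup>2)" by (subst sum.reindex[OF inj]) simp
    also have "\<dots> \<le> (\<Sum>b\<in>{1..m}. 1 / (real b + 1)\<^sup>2)" using m by (intro sum_mono2) auto
    also have "\<dots> \<le> 1" using tel[of m] by (smt (verit) divide_nonneg_nonneg of_nat_0_le_iff)
    finally show "(\<Sum>w\<in>S. word_weight B w powr - 1) \<le> 1" .
  qed
  from level_sum_le_mult[OF assms _ this, of n] show ?thesis by simp
qed

section \<open>The levels \<open>s_level\<close> and their limit\<close>

lemma s_level_eq: "1 < B \<Longrightarrow> s_level B n = Inf {\<rho>. 0 \<le> \<rho> \<and> level_sum_le B n \<rho> 1}"
  by (simp add: s_level_def s_level_sum_le_iff)

lemma s_level_nonneg: "1 < B \<Longrightarrow> 0 \<le> s_level B n"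
  unfolding s_level_eq using level_sum_le_one[of B n] by (intro cInf_greatest) (auto intro: exI[of _ 1])

lemma bdd_below_s_level: "1 < B \<Longrightarrow> bdd_below (s_level B ` A)"
  by (intro bdd_belowI2[of _ 0] s_level_nonneg)

lemma s_level_le: "1 < B \<Longrightarrow> 0 \<le> \<rho> \<Longrightarrow> level_sum_le B n \<rho> 1 \<Longrightarrow> s_level B n \<le> \<rho>"
  unfolding s_level_eq by (intro cInf_lower) (auto intro: bdd_belowI[of _ 0])

lemma s_level_lessD:
  assumes "1 < B" "s_level B n < s"
  shows "\<exists>\<rho>. 0 \<le> \<rho> \<and> \<rho> < s \<and> level_sum_le B n \<rho> 1"
proof -
  have "{\<rho>. 0 \<le> \<rho> \<and> level_sum_le B n \<rho> 1} \<noteq> {}" using level_sum_le_one[OF assms(1), of n] by (auto intro: exI[of _ 1])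
  from cInf_lessD[OF this] show ?thesis using assms by (auto simp: s_level_eq)
qed

lemma level_sum_le_exponential:
  assumes "1 < B" "1 \<le> n" "s_level B n < s"
  shows "\<exists>C \<beta>. 0 < \<beta> \<and> \<beta> < 1 \<and> (\<forall>m. level_sum_le B m s (C * \<beta> ^ m))"
proof -
  obtain \<rho> where \<rho>: "0 \<le> \<rho>" "\<rho> < s" "level_sum_le B n \<rho> 1" using s_level_lessD[OF assms(1,3)] by blast
  obtain C where C: "\<And>m. level_sum_le B m \<rho> C" using level_sum_le_bounded[OF assms(1) \<rho>(1) assms(2) \<rho>(3)] by blast
  show ?thesis
    using level_sum_le_decay[OF assms(1) _ C] \<rho> assms(1)
    by (intro exI[of _ C] exI[of _ "B powr (- 2 * (s - \<rho>))"]) (auto simp: powr_less_one)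
qed

text \<open>A Fekete type argument: an exponent above one level makes the sums decay exponentially,
  so they drop below 1 at all large levels. Level 0 is left out, since its only term is 1 at every
  exponent and \<open>s_level B 0\<close> is 0.\<close>

lemma s_limit_eq_Inf:
  assumes "1 < B"
  shows "s_limit B = (INF n\<in>{1..}. s_level B n)"
proof -
  let ?S = "INF n\<in>{1..}. s_level B n"
  note bdd = bdd_below_s_level[OF assms, of "{1..}"]
  have "s_level B \<longlonglongrightarrow> ?S"
  proof (rule order_tendstoI)
    fix a assume "a < ?S"
    then have "a < s_level B m" if "m \<ge> 1" for m
      using cINF_lower[OF bdd, of m] that by auto
    then show "eventually (\<lambda>m. a < s_level B m) sequentially"
      using eventually_sequentially by blast
  next
    fix a assume "?S < a"
    then obtain n where n: "1 \<le> n" "s_level B n < a"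
      using cINF_less_iff[OF _ bdd, of a] by auto
    define s where "s = (s_level B n + a) / 2"
    have s: "s_level B n < s" "s < a" "0 \<le> s" using n s_level_nonneg[OF assms, of n] by (auto simp: s_def)
    obtain C \<beta> where C: "0 < \<beta>" "\<beta> < 1" "\<And>m. level_sum_le B m s (C * \<beta> ^ m)"
      using level_sum_le_exponential[OF assms n(1) s(1)] by blast
    have "(\<lambda>m. C * \<beta> ^ m) \<longlonglongrightarrow> C * 0"
      using C(1,2) by (intro tendsto_mult tendsto_const LIMSEQ_realpow_zero) auto
    then have "eventually (\<lambda>m. C * \<beta> ^ m < 1) sequentially" by (intro order_tendstoD) auto
    then show "eventually (\<lambda>m. s_level B m < a) sequentially"
    proof eventually_elim
      case (elim m)
      then have "s_level B m \<le> s"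
        using level_sum_le_mono[OF C(3)] s(3) by (intro s_level_le[OF assms]) auto
      then show ?case using s(2) by simp
    qed
  qed
  then show ?thesis unfolding s_limit_def by (rule limI)
qed

lemma s_limit_nonneg: "1 < B \<Longrightarrow> 0 \<le> s_limit B"
  unfolding s_limit_eq_Inf by (intro cINF_greatest) (auto simp: s_level_nonneg)

lemma s_limit_le_s_level:
  assumes "1 < B" "1 \<le> n"
  shows "s_limit B \<le> s_level B n"
  unfolding s_limit_eq_Inf[OF assms(1)] using bdd_below_s_level[OF assms(1)] assms(2)
  by (intro cINF_lower) auto

lemma s_limit_lessD:
  assumes "1 < B" "s_limit B < s"
  shows "\<exists>n\<ge>1. s_level B n < s"
proof -
  have "bdd_below (s_level B ` {1..})" by (rule bdd_below_s_level[OF assms(1)])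
  then show ?thesis using cINF_less_iff[of "{1..}" "s_level B" s] assms by (auto simp: s_limit_eq_Inf)
qed

section \<open>Upper bound\<close>

text \<open>A large digit a after w puts the remaining tail at 1 - 1 / (a + 1 + y), close to the
  right endpoint 1.\<close>

lemma branch_near_1_cover:
  assumes "1 < B" "x \<in> F_set B"
  shows "\<exists>n\<ge>N. \<exists>w\<in>pos_words n. x \<in> branch w ` {1 - 1 / B ^ (2 * n)..1}"
proof -
  have x: "x \<in> I_even" "\<exists>\<^sub>\<infinity>n. B ^ (2 * n) \<le> real (partial_quotient x (2 * n))"
    using assms(2) by (auto simp: F_set_def)
  obtain m where m: "N < m" "B ^ (2 * m) \<le> real (partial_quotient x (2 * m))"
    using x(2) by (auto simp: INFM_nat)
  \<comment> \<open>The word collects the even digits before the large one, hence is one letter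
    shorter than m; weakening B^(2m) to B^(2n) matches the exponent to the length of w.\<close>
  define n where "n = m - 1"
  have n: "N \<le> n" "m = Suc n" using m(1) by (auto simp: n_def)
  obtain w z where w: "w \<in> pos_words n" "z \<in> I_even" "x = branch w z"
    and pq: "partial_quotient z 2 = partial_quotient x (2 * m)"
    using I_even_expansion[OF x(1), of n] n by auto
  define a where "a = partial_quotient z 2"
  define y where "y = gauss_map (gauss_map z)"
  have "y \<in> I_even" and z: "z = branch [a] y"
    using I_even_step(1,3)[OF w(2)] by (simp_all add: y_def a_def del: branch.simps)
  then have y: "0 \<le> y" by (simp add: I_even_def)
  have "B ^ (2 * n) \<le> B ^ (2 * m)" using assms(1) n by (intro power_increasing) auto
  also have "\<dots> \<le> real a" using m(2) pq by (simp add: a_def)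
  finally have "B ^ (2 * n) \<le> real a + 1 + y" using y by simp
  moreover have "0 < B ^ (2 * n)" using assms(1) by simp
  ultimately have "1 / (real a + 1 + y) \<le> 1 / B ^ (2 * n)" by (intro divide_left_mono) auto
  moreover have "z = 1 - 1 / (real a + 1 + y)" by (simp add: z)
  moreover have "z \<le> 1" using w(2) by (simp add: I_even_def)
  ultimately have "z \<in> {1 - 1 / B ^ (2 * n)..1}" by auto
  then show ?thesis using n w by blast
qed

lemma diameter_branch_near_1_le:
  assumes "1 < B" "w \<in> pos_words n"
  defines "U \<equiv> branch w ` {1 - 1 / B ^ (2 * n)..1}"
  shows "bounded U" "diameter U \<le> 1 / word_weight B w"
proof -
  have len: "length w = n" using assms by (simp add: pos_words_def)
  have B: "0 < B ^ (2 * n)" "1 / B ^ (2 * n) \<le> 1" using assms(1) by simp_all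
  have d: "\<bar>u - v\<bar> \<le> 1 / word_weight B w" if uv: "u \<in> U" "v \<in> U" for u v
  proof -
    obtain x y where xy: "u = branch w x" "v = branch w y" "x \<in> {1 - 1 / B ^ (2 * n)..1}" "y \<in> {1 - 1 / B ^ (2 * n)..1}"
      using uv unfolding U_def by blast
    then have in01: "x \<in> {0..1}" "y \<in> {0..1}"
      using B(2) unfolding atLeastAtMost_iff by linarith+
    have "denom w 0 * denom w 0 \<le> denom w x * denom w y"
      using denom_mono[of 0 x w] denom_mono[of 0 y w] in01 denom_ge_1[of 0 w] by (intro mult_mono) auto
    moreover have "\<bar>x - y\<bar> \<le> 1 / B ^ (2 * n)" using xy by (auto simp: abs_le_iff)
    ultimately have "\<bar>x - y\<bar> / (denom w x * denom w y) \<le> (1 / B ^ (2 * n)) / (denom w 0 * denom w 0)"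
      using denom_pos[of 0 w] by (intro frac_le) auto
    moreover have "\<bar>u - v\<bar> = \<bar>x - y\<bar> / (denom w x * denom w y)"
      using denom_pos[OF in01(1), of w] denom_pos[OF in01(2), of w]
      by (simp add: xy branch_diff[OF in01] abs_mult)
    ultimately show ?thesis by (simp add: word_weight_def len power2_eq_square)
  qed
  have "{1 - 1 / B ^ (2 * n)..1} \<subseteq> {0..1}" using B(2) by (intro atLeastatMost_subset_iff[THEN iffD2]) linarith
  then have "U \<subseteq> {0..1}" unfolding U_def using branch_in by blast
  then show "bounded U" using bounded_closed_interval bounded_subset by blast
  show "diameter U \<le> 1 / word_weight B w"
    using d word_weight_ge_1(2)[OF assms(1), of w] by (intro diameter_le) (auto simp: dist_real_def)
qed

text \<open>A Borel-Cantelli argument: for every N the words of length at least N already give a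
  cover, and their s-sums are bounded by the tail of a geometric series.\<close>

lemma hausdorff_measure_F_set_eq_0:
  assumes "1 < B" "s_limit B < s"
  shows "hausdorff_measure s (F_set B) = 0"
proof (rule hausdorff_measure_eq_0I)
  fix \<delta> \<epsilon> :: real
  assume pos: "0 < \<delta>" "0 < \<epsilon>"
  have s: "0 < s" using s_limit_nonneg[OF assms(1)] assms(2) by linarith
  obtain n where "1 \<le> n" "s_level B n < s" using s_limit_lessD[OF assms] by blast
  from level_sum_le_exponential[OF assms(1) this] obtain C \<beta>
    where \<beta>: "0 < \<beta>" "\<beta> < 1" and C: "\<And>m. level_sum_le B m s (C * \<beta> ^ m)" by blast
  have C0: "0 \<le> C" using level_sum_le_nonneg[OF C[of 0]] by simp
  have "(\<lambda>m. (1 / B\<^sup>2) ^ m) \<longlonglongrightarrow> 0" using assms(1) by (intro LIMSEQ_realpow_zero) auto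
  then have "eventually (\<lambda>m. (1 / B\<^sup>2) ^ m < \<delta>) sequentially" using pos by (intro order_tendstoD) auto
  moreover have "(\<lambda>m. C / (1 - \<beta>) * \<beta> ^ m) \<longlonglongrightarrow> C / (1 - \<beta>) * 0"
    using \<beta> by (intro tendsto_mult tendsto_const LIMSEQ_realpow_zero) auto
  then have "eventually (\<lambda>m. C / (1 - \<beta>) * \<beta> ^ m < \<epsilon>) sequentially" using pos by (intro order_tendstoD) auto
  ultimately have "eventually (\<lambda>m. (1 / B\<^sup>2) ^ m < \<delta> \<and> C / (1 - \<beta>) * \<beta> ^ m < \<epsilon>) sequentially"
    by (rule eventually_conj)
  \<comment> \<open>N serves two purposes: it makes all diameters less than \<delta> and the
    geometric tail less than \<epsilon>.\<close>
  then obtain N where N: "(1 / B\<^sup>2) ^ N < \<delta>" "C / (1 - \<beta>) * \<beta> ^ N < \<epsilon>"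
    using eventually_happens'[OF sequentially_bot] by blast
  define U where "U w = branch w ` {1 - 1 / B ^ (2 * length w)..1}" for w
  define A where "A = (\<Union>n\<in>{N..}. pos_words n)"
  have A_len: "w \<in> pos_words (length w)" "N \<le> length w" if "w \<in> A" for w
    using that by (auto simp: A_def pos_words_def)
  have diam: "bounded (U w)" "diameter (U w) \<le> 1 / word_weight B w" if "w \<in> A" for w
    using diameter_branch_near_1_le[OF assms(1) A_len(1)[OF that]] by (simp_all add: U_def)
  show "hausdorff_premeasure s \<delta> (F_set B) \<le> ennreal \<epsilon>"
  proof (rule hausdorff_premeasure_le_countable_cover[where U = U and A = A])
    show "F_set B \<subseteq> (\<Union>w\<in>A. U w)"
    proof
      fix x assume "x \<in> F_set B"
      then obtain n w where "N \<le> n" "w \<in> pos_words n" "x \<in> branch w ` {1 - 1 / B ^ (2 * n)..1}"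
        using branch_near_1_cover[OF assms(1)] by blast
      moreover from this have "length w = n" by (simp add: pos_words_def)
      ultimately show "x \<in> (\<Union>w\<in>A. U w)" unfolding A_def U_def by blast
    qed
    show "0 \<le> \<delta>" using pos by simp
    show "bounded (U w) \<and> diameter (U w) \<le> \<delta>" if "w \<in> A" for w
    proof -
      have "B ^ (2 * N) \<le> B ^ (2 * length w)"
        using A_len(2)[OF that] assms(1) by (intro power_increasing) auto
      also have "\<dots> \<le> word_weight B w" by (rule word_weight_ge_1(1)[OF assms(1)])
      finally have "1 / word_weight B w \<le> 1 / B ^ (2 * N)"
        using assms(1) by (intro divide_left_mono) (auto simp: less_le_trans[of 0 "B ^ (2 * N)"])
      then show ?thesis using diam[OF that] N(1) by (simp add: power_one_over power_mult)
    qed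
    fix S assume S: "finite S" "S \<subseteq> A"
    have "(\<Sum>w\<in>S. diam_powr s (U w)) \<le> (\<Sum>w\<in>S. ennreal (word_weight B w powr - s))"
    proof (rule sum_mono)
      fix w assume "w \<in> S"
      then have w: "w \<in> A" using S by blast
      have "diameter (U w) powr s \<le> (1 / word_weight B w) powr s"
        using diam[OF w] s by (intro powr_mono2) (auto simp: diameter_ge_0)
      also have "\<dots> = word_weight B w powr - s"
        using word_weight_ge_1(2)[OF assms(1), of w] by (simp add: powr_minus_divide powr_divide)
      finally show "diam_powr s (U w) \<le> ennreal (word_weight B w powr - s)"
        using s by (auto simp: diam_powr_def intro: ennreal_leI)
    qed
    also have "\<dots> = ennreal (\<Sum>w\<in>S. word_weight B w powr - s)" by simp
    also have "\<dots> \<le> ennreal \<epsilon>"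
    proof (rule ennreal_leI)
      obtain k where k: "\<And>m. m \<in> length ` S \<Longrightarrow> m < k"
        using S(1) finite_nat_set_iff_bounded[of "length ` S"] by blast
      have k: "length ` S \<subseteq> (+) N ` {..<k}"
      proof
        fix m assume m: "m \<in> length ` S"
        then have "m = N + (m - N)" using A_len(2) S(2) by auto
        moreover have "m - N < k" using k[OF m] by simp
        ultimately show "m \<in> (+) N ` {..<k}" by blast
      qed
      have "(\<Sum>w\<in>S. word_weight B w powr - s)
          = (\<Sum>m\<in>length ` S. \<Sum>w\<in>{w\<in>S. length w = m}. word_weight B w powr - s)"
        by (rule sum.image_gen[OF S(1)])
      also have "\<dots> \<le> (\<Sum>m\<in>length ` S. C * \<beta> ^ m)"
        using S A_len(1) by (intro sum_mono level_sum_leD[OF C]) force+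
      also have "\<dots> \<le> (\<Sum>m\<in>(+) N ` {..<k}. C * \<beta> ^ m)"
        using C0 \<beta> by (intro sum_mono2[OF _ k]) auto
      also have "\<dots> = C * \<beta> ^ N * (\<Sum>i<k. \<beta> ^ i)"
        by (subst sum.reindex) (auto simp: power_add sum_distrib_left mult.assoc)
      also have "\<dots> \<le> C * \<beta> ^ N * (1 / (1 - \<beta>))"
      proof (intro mult_left_mono)
        show "(\<Sum>i<k. \<beta> ^ i) \<le> 1 / (1 - \<beta>)"
          using \<beta> by (simp add: sum_gp_strict divide_right_mono)
      qed (use C0 \<beta> in auto)
      also have "\<dots> \<le> \<epsilon>" using N(2) by (simp add: field_simps)
      finally show "(\<Sum>w\<in>S. word_weight B w powr - s) \<le> \<epsilon>" .
    qed
    finally show "(\<Sum>w\<in>S. diam_powr s (U w)) \<le> ennreal \<epsilon>" .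
  qed
qed

section \<open>Lower bound\<close>

lemma continuous_on_branch: "continuous_on {0..1} (branch w)"
proof (induction w)
  case (Cons b w)
  have "real b + 1 + branch w x \<noteq> 0" if "x \<in> {0..1}" for x
    using branch_bounds(1)[OF that, of w] by linarith
  with Cons show ?case by (auto intro!: continuous_intros)
qed simp

abbreviation word_prefix :: "(nat \<Rightarrow> nat list) \<Rightarrow> nat \<Rightarrow> nat list" where
  "word_prefix ws j \<equiv> concat (map ws [0..<j])"

definition word_limit :: "(nat \<Rightarrow> nat list) \<Rightarrow> real" where
  "word_limit ws = lim (\<lambda>j. branch (word_prefix ws j) 0)"

lemma word_prefix_Suc: "word_prefix ws (Suc j) = ws 0 @ word_prefix (\<lambda>k. ws (Suc k)) j"
proof -
  have "[0..<Suc j] = 0 # map Suc [0..<j]" by (simp add: map_Suc_upt upt_conv_Cons del: upt_Suc)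
  then show ?thesis by (simp add: comp_def del: upt_Suc)
qed

text \<open>Prefixes are evaluated at 0 because branches are increasing and send 0 to nonnegative
  values: the approximations then increase and stay at most 1.\<close>

lemma word_limit: "(\<lambda>j. branch (word_prefix ws j) 0) \<longlonglongrightarrow> word_limit ws"
proof -
  have "incseq (\<lambda>j. branch (word_prefix ws j) 0)"
  proof (rule incseq_SucI)
    fix j
    have "branch (ws j) 0 \<in> {0..1}" by (rule branch_in) simp
    then show "branch (word_prefix ws j) 0 \<le> branch (word_prefix ws (Suc j)) 0"
      by (simp add: branch_append branch_mono)
  qed
  then have "convergent (\<lambda>j. branch (word_prefix ws j) 0)"
    using branch_bounds(2)[of 0] by (auto intro!: Bseq_mono_convergent BseqI'[of _ 1] incseqD
        simp: branch_bounds(1))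
  then show ?thesis unfolding word_limit_def convergent_LIMSEQ_iff .
qed

lemma word_limit_in: "word_limit ws \<in> {0..1}"
  using branch_in[of 0] by (intro closed_sequentially[OF _ _ word_limit]) auto

lemma word_limit_rec: "word_limit ws = branch (ws 0) (word_limit (\<lambda>k. ws (Suc k)))"
proof -
  let ?v = "\<lambda>k. ws (Suc k)"
  have "(\<lambda>j. branch (ws 0) (branch (word_prefix ?v j) 0)) \<longlonglongrightarrow> branch (ws 0) (word_limit ?v)"
    using branch_in[of 0]
    by (intro continuous_on_tendsto_compose[OF continuous_on_branch word_limit word_limit_in]) auto
  then have "(\<lambda>j. branch (word_prefix ws (Suc j)) 0) \<longlonglongrightarrow> branch (ws 0) (word_limit ?v)"
    unfolding word_prefix_Suc branch_append .
  then show ?thesis using LIMSEQ_unique[OF LIMSEQ_Suc[OF word_limit]] by blast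
qed

lemma word_limit_prefix: "word_limit ws = branch (word_prefix ws j) (word_limit (\<lambda>k. ws (j + k)))"
proof (induction j)
  case (Suc j)
  then show ?case using word_limit_rec[of "\<lambda>k. ws (j + k)"] by (simp add: branch_append)
qed simp

lemma word_limit_gt_half:
  assumes "\<And>j. ws j \<noteq> []" "\<And>j b. b \<in> set (ws j) \<Longrightarrow> 1 \<le> b"
  shows "word_limit ws \<in> {1/2..<1}"
proof -
  obtain b v where b: "ws 0 = b # v" using assms(1) by (cases "ws 0") auto
  then have "1 \<le> b" using assms(2)[of b 0] by simp
  then show ?thesis
    using branch_Cons_gt_half[OF word_limit_in] word_limit_rec[of ws] b by metis
qed

lemma denom_word_prefix_le:
  assumes "\<And>k x. k < j \<Longrightarrow> x \<in> {0..1} \<Longrightarrow> denom (ws k) x \<le> Q k" "x \<in> {0..1}"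
  shows "denom (word_prefix ws j) x \<le> (\<Prod>k<j. Q k)"
  using assms
proof (induction j arbitrary: x)
  case (Suc j)
  have y: "branch (ws j) x \<in> {0..1}" using Suc.prems(2) by (rule branch_in)
  have "denom (word_prefix ws j) (branch (ws j) x) * denom (ws j) x \<le> (\<Prod>k<j. Q k) * Q j"
    using Suc.IH[OF _ y] Suc.prems denom_pos[OF Suc.prems(2), of "ws j"] denom_pos[OF y, of "word_prefix ws j"]
    by (intro mult_mono) (auto intro: order_trans[OF less_imp_le])
  then show ?case by (simp add: denom_append)
qed simp

section \<open>Mixed radix expansion of the parameter\<close>

primrec radix_rem :: "(nat \<Rightarrow> nat) \<Rightarrow> real \<Rightarrow> nat \<Rightarrow> real" where
  "radix_rem N t 0 = t"
| "radix_rem N t (Suc j) = frac (real (N j) * radix_rem N t j)"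

definition radix_digit :: "(nat \<Rightarrow> nat) \<Rightarrow> real \<Rightarrow> nat \<Rightarrow> nat" where
  "radix_digit N t j = nat \<lfloor>real (N j) * radix_rem N t j\<rfloor>"

lemma radix_rem_in: "t \<in> {0..<1} \<Longrightarrow> radix_rem N t j \<in> {0..<1}"
  by (cases j) (auto simp: frac_lt_1)

lemma radix_rem_eq:
  assumes "t \<in> {0..<1}"
  shows "real (N j) * radix_rem N t j = real (radix_digit N t j) + radix_rem N t (Suc j)"
  using radix_rem_in[OF assms, of N j] by (simp add: radix_digit_def frac_def)

lemma radix_digit_less:
  assumes "t \<in> {0..<1}" "0 < N j"
  shows "radix_digit N t j < N j"
proof -
  have "real (N j) * radix_rem N t j < real (N j) * 1"
    using radix_rem_in[OF assms(1), of N j] assms(2) by (intro mult_strict_left_mono) auto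
  moreover have "0 \<le> radix_rem N t (Suc j)" using radix_rem_in[OF assms(1), of N "Suc j"] by simp
  ultimately show ?thesis using radix_rem_eq[OF assms(1), of N j] by linarith
qed

text \<open>Parameters with j common digits lie in one cylinder, whose length is the product; the
  rescaled remainders locate them inside it.\<close>

lemma radix_diff:
  assumes "t \<in> {0..<1}" "t' \<in> {0..<1}" "\<And>j. 0 < N j"
    and "\<And>k. k < j \<Longrightarrow> radix_digit N t k = radix_digit N t' k"
  shows "t - t' = (\<Prod>k<j. 1 / real (N k)) * (radix_rem N t j - radix_rem N t' j)"
  using assms(4)
proof (induction j)
  case (Suc j)
  have "real (N j) * (radix_rem N t j - radix_rem N t' j) = radix_rem N t (Suc j) - radix_rem N t' (Suc j)"
    using radix_rem_eq[OF assms(1), of N j] radix_rem_eq[OF assms(2), of N j] Suc.prems[of j]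
    by (simp add: right_diff_distrib)
  then have "radix_rem N t j - radix_rem N t' j = 1 / real (N j) * (radix_rem N t (Suc j) - radix_rem N t' (Suc j))"
    using assms(3)[of j] by (simp add: field_simps)
  moreover have "t - t' = (\<Prod>k<j. 1 / real (N k)) * (radix_rem N t j - radix_rem N t' j)"
    using Suc by simp
  ultimately show ?case by simp
qed simp

lemma radix_digit_neq:
  assumes "t \<in> {0..<1}" "t' \<in> {0..<1}" "\<And>j. 2 \<le> N j" "t \<noteq> t'"
  shows "\<exists>j. radix_digit N t j \<noteq> radix_digit N t' j"
proof (rule ccontr)
  assume "\<nexists>j. radix_digit N t j \<noteq> radix_digit N t' j"
  then have same: "radix_digit N t j = radix_digit N t' j" for j by blast
  have N0: "0 < N j" for j using assms(3)[of j] by linarith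
  have "\<bar>t - t'\<bar> \<le> (1 / 2) ^ j" for j
  proof -
    have "(\<Prod>k<j. 1 / real (N k)) \<le> (\<Prod>k<j. 1 / 2)"
      using assms(3) N0 by (intro prod_mono) (auto simp: field_simps)
    moreover have "\<bar>radix_rem N t j - radix_rem N t' j\<bar> \<le> 1"
      using radix_rem_in[OF assms(1), of N j] radix_rem_in[OF assms(2), of N j] by auto
    ultimately have "(\<Prod>k<j. 1 / real (N k)) * \<bar>radix_rem N t j - radix_rem N t' j\<bar> \<le> (1 / 2) ^ j * 1"
      by (intro mult_mono) auto
    moreover have "\<bar>t - t'\<bar> = (\<Prod>k<j. 1 / real (N k)) * \<bar>radix_rem N t j - radix_rem N t' j\<bar>"
      using radix_diff[OF assms(1,2) N0 same, of j] by (simp add: abs_mult prod_nonneg)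
    ultimately show ?thesis by simp
  qed
  moreover have "(\<lambda>j. (1 / 2 :: real) ^ j) \<longlonglongrightarrow> 0" by (intro LIMSEQ_realpow_zero) auto
  ultimately have "\<bar>t - t'\<bar> \<le> 0" by (intro LIMSEQ_le_const) auto
  then show False using assms(4) by simp
qed

text \<open>Reduces the global estimate to a single stage. Let j be the first stage where the digits
  differ: the common prefix shrinks distances by at most the square of the product of the Q k, while
  both parameters lie in a cylinder whose length is the product of the 1 / N k. \<open>sep\<close>
  compares the two effects.\<close>

lemma word_limit_radix_expanding:
  fixes N :: "nat \<Rightarrow> nat" and W :: "nat \<Rightarrow> nat \<Rightarrow> nat list"
  assumes N: "\<And>j. 2 \<le> N j"
    and W: "\<And>j i. i < N j \<Longrightarrow> W j i \<noteq> []" "\<And>j i b. i < N j \<Longrightarrow> b \<in> set (W j i) \<Longrightarrow> 1 \<le> b"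
    and Q: "\<And>j i x. i < N j \<Longrightarrow> x \<in> {0..1} \<Longrightarrow> denom (W j i) x \<le> Q j"
    and "0 \<le> C" "0 \<le> s"
    and sep: "\<And>j i i' y y'. i < N j \<Longrightarrow> i' < N j \<Longrightarrow> i \<noteq> i' \<Longrightarrow> y \<in> {1/2..<1} \<Longrightarrow> y' \<in> {1/2..<1} \<Longrightarrow>
      (\<bar>real i - real i'\<bar> + 1) / real (N j) * (\<Prod>k<j. 1 / real (N k))
        \<le> C * (\<bar>branch (W j i) y - branch (W j i') y'\<bar> / (\<Prod>k<j. Q k)\<^sup>2) powr s"
    and t: "t \<in> {0..<1}" "t' \<in> {0..<1}"
  defines "x \<equiv> \<lambda>t. word_limit (\<lambda>j. W j (radix_digit N t j))"
  shows "\<bar>t - t'\<bar> \<le> C * \<bar>x t - x t'\<bar> powr s"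
proof (cases "t = t'")
  case True
  then show ?thesis using \<open>0 \<le> C\<close> by simp
next
  case False
  define ws where "ws t j = W j (radix_digit N t j)" for t j
  define j where "j = (LEAST j. radix_digit N t j \<noteq> radix_digit N t' j)"
  have N0: "0 < N j" for j using N[of j] by linarith
  have neq: "radix_digit N t j \<noteq> radix_digit N t' j"
    unfolding j_def by (rule LeastI_ex[OF radix_digit_neq[OF t N False]])
  have same: "radix_digit N t k = radix_digit N t' k" if "k < j" for k
    using that not_less_Least unfolding j_def by blast
  define i i' where "i = radix_digit N t j" and "i' = radix_digit N t' j"
  have digit: "radix_digit N u k < N k" if "u \<in> {0..<1}" for u k
    by (rule radix_digit_less[where N = N, OF that N0])
  have i: "i < N j" "i' < N j" unfolding i_def i'_def by (intro digit t)+
  define P where "P = (\<Prod>k<j. 1 / real (N k))"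
  have P0: "0 \<le> P" unfolding P_def by (intro prod_nonneg) auto
  have y: "word_limit (\<lambda>k. ws u (Suc j + k)) \<in> {1/2..<1}" if "u \<in> {0..<1}" for u
    unfolding ws_def
    by (rule word_limit_gt_half, rule W(1)[OF digit[OF that]], rule W(2)[OF digit[OF that]])
  define y y' where "y = word_limit (\<lambda>k. ws t (Suc j + k))" and "y' = word_limit (\<lambda>k. ws t' (Suc j + k))"
  define z z' where "z = branch (W j i) y" and "z' = branch (W j i') y'"
  have z01: "z \<in> {0..1}" "z' \<in> {0..1}"
    unfolding z_def z'_def y_def y'_def by (intro branch_in word_limit_in)+
  define v where "v = word_prefix (ws t) j"
  have v': "v = word_prefix (ws t') j"
    unfolding v_def ws_def by (intro arg_cong[of _ _ concat] map_cong refl) (simp add: same)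
  have "x t = branch v z"
    unfolding x_def ws_def[symmetric] by (subst word_limit_prefix[of _ "Suc j"])
      (simp add: z_def y_def v_def branch_append i_def ws_def)
  moreover have "x t' = branch v z'"
    unfolding x_def ws_def[symmetric] by (subst word_limit_prefix[of _ "Suc j"])
      (simp add: z'_def y'_def v' branch_append i'_def ws_def)
  ultimately have dist: "\<bar>x t - x t'\<bar> = \<bar>z - z'\<bar> / (denom v z * denom v z')"
    using denom_pos[OF z01(1), of v] denom_pos[OF z01(2), of v]
    by (simp add: branch_diff[OF z01] abs_mult)
  have den: "denom v u \<le> (\<Prod>k<j. Q k)" if "u \<in> {0..1}" for u
    unfolding v_def using Q[OF digit[OF t(1)]] that
    by (intro denom_word_prefix_le) (auto simp: ws_def)
  have prod_pos: "0 < denom v z * denom v z'" using denom_pos z01 by simp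
  have "denom v z * denom v z' \<le> (\<Prod>k<j. Q k) * (\<Prod>k<j. Q k)"
    using den[OF z01(1)] den[OF z01(2)] denom_pos[OF z01(1), of v] denom_pos[OF z01(2), of v]
    by (intro mult_mono) auto
  then have le: "\<bar>z - z'\<bar> / (\<Prod>k<j. Q k)\<^sup>2 \<le> \<bar>x t - x t'\<bar>"
    unfolding dist power2_eq_square using prod_pos by (intro divide_left_mono) auto
  \<comment> \<open>The remainders after stage j lie in [0,1) and change the digit difference by
    less than 1, hence the extra 1.\<close>
  have "\<bar>radix_rem N t j - radix_rem N t' j\<bar> \<le> (\<bar>real i - real i'\<bar> + 1) / real (N j)"
  proof -
    have "\<bar>real (N j) * radix_rem N t j - real (N j) * radix_rem N t' j\<bar> \<le> \<bar>real i - real i'\<bar> + 1"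
      using radix_rem_eq[OF t(1), of N j] radix_rem_eq[OF t(2), of N j]
        radix_rem_in[OF t(1), of N "Suc j"] radix_rem_in[OF t(2), of N "Suc j"]
      unfolding i_def i'_def atLeastLessThan_iff by linarith
    then have "real (N j) * \<bar>radix_rem N t j - radix_rem N t' j\<bar> \<le> \<bar>real i - real i'\<bar> + 1"
      by (simp add: right_diff_distrib[symmetric] abs_mult)
    then show ?thesis using N0[of j] by (simp add: field_simps)
  qed
  then have "P * \<bar>radix_rem N t j - radix_rem N t' j\<bar> \<le> P * ((\<bar>real i - real i'\<bar> + 1) / real (N j))"
    using P0 by (intro mult_left_mono)
  then have "\<bar>t - t'\<bar> \<le> (\<bar>real i - real i'\<bar> + 1) / real (N j) * P"
    using radix_diff[where N = N, OF t N0 same] P0 by (simp add: P_def[symmetric] abs_mult mult.commute)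
  also have "\<dots> \<le> C * (\<bar>z - z'\<bar> / (\<Prod>k<j. Q k)\<^sup>2) powr s"
    unfolding z_def z'_def P_def using i neq y[OF t(1)] y[OF t(2)]
    by (intro sep) (auto simp: i_def i'_def y_def y'_def)
  also have "\<dots> \<le> C * \<bar>x t - x t'\<bar> powr s"
    using le \<open>0 \<le> C\<close> \<open>0 \<le> s\<close> by (intro mult_left_mono powr_mono2) auto
  finally show ?thesis .
qed

text \<open>Below the limit the sum at \<open>s1\<close> exceeds 1 at every positive level. If each
  dyadic class of denominators had few words, the classes would contribute geometrically decaying
  amounts with total below 1 for large L.\<close>

lemma equidenominator_block_exists:
  assumes "1 < B" "0 \<le> s" "s < s_limit B"
  shows "\<exists>L A Q. 1 \<le> L \<and> finite A \<and> A \<subseteq> pos_words L \<and> 1 \<le> Q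
    \<and> (\<forall>w\<in>A. \<forall>x\<in>{0..1}. denom w x \<le> Q) \<and> 2 * (B ^ (2 * L) * Q\<^sup>2) powr s \<le> real (card A)"
proof -
  define s1 where "s1 = (s + s_limit B) / 2"
  define d where "d = s1 - s"
  have d: "0 < d" and s1: "s1 < s_limit B" "0 \<le> s1" using assms(2,3) by (auto simp: d_def s1_def)
  \<comment> \<open>Class j has squared denominators of order 4^j, so passing from s to s1 = s + d
    gains \<open>r ^ j\<close>. \<open>K\<close> is the resulting geometric total without the factor
    in B, and determines how large L has to be.\<close>
  define r where "r = (4::real) powr - d"
  have r: "0 < r" "r < 1" using d by (auto simp: r_def powr_less_one)
  define K where "K = 2 * 16 powr s / (1 - r)"
  have "(\<lambda>L. K * (B powr (- 2 * d)) ^ L) \<longlonglongrightarrow> K * 0"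
    using d assms(1) by (intro tendsto_mult tendsto_const LIMSEQ_realpow_zero) (auto simp: powr_less_one)
  then have "eventually (\<lambda>L. K * (B powr (- 2 * d)) ^ L < 1) sequentially" by (intro order_tendstoD) auto
  then have "eventually (\<lambda>L. K * (B powr (- 2 * d)) ^ L < 1 \<and> 1 \<le> L) sequentially"
    by (intro eventually_conj eventually_ge_at_top)
  then obtain L where L: "K * (B powr (- 2 * d)) ^ L < 1" "1 \<le> L"
    using eventually_happens'[OF sequentially_bot] by blast
  have "\<not> level_sum_le B L s1 1"
    using s_level_le[OF assms(1) s1(2), of L] s_limit_le_s_level[OF assms(1) L(2)] s1(1) by linarith
  then obtain S where S: "finite S" "S \<subseteq> pos_words L" "1 < (\<Sum>w\<in>S. word_weight B w powr - s1)"
    by (auto simp: level_sum_le_def not_le)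
  define g where "g w = nat \<lfloor>log 2 (denom w 0)\<rfloor>" for w
  have g: "2 ^ g w \<le> denom w 0" "denom w 0 < 2 * 2 ^ g w" for w
  proof -
    have "1 \<le> denom w 0" by (simp add: denom_ge_1)
    then have "real (g w) \<le> log 2 (denom w 0)" "log 2 (denom w 0) < real (g w) + 1"
      by (auto simp: g_def)
    then have "2 powr real (g w) \<le> denom w 0" "denom w 0 < 2 powr (real (g w) + 1)"
      using \<open>1 \<le> denom w 0\<close> by (simp_all add: le_log_iff log_less_iff)
    then show "2 ^ g w \<le> denom w 0" "denom w 0 < 2 * 2 ^ g w"
      by (simp_all add: powr_add powr_realpow)
  qed
  define T where "T j = {w \<in> S. g w = j}" for j
  \<comment> \<open>In the denominator bound 4 * 2^j one factor 2 comes from the width of the dyadic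
    class and one from \<open>denom_le_double\<close>. The leading 2 of the count is what later
    makes ordinary stages gain mass.\<close>
  have "\<exists>j. 2 * (B ^ (2 * L) * (4 * 2 ^ j)\<^sup>2) powr s \<le> real (card (T j))"
  proof (rule ccontr)
    assume "\<nexists>j. 2 * (B ^ (2 * L) * (4 * 2 ^ j)\<^sup>2) powr s \<le> real (card (T j))"
    then have small: "real (card (T j)) \<le> 2 * (B ^ (2 * L) * (4 * 2 ^ j)\<^sup>2) powr s" for j
      by (meson not_le less_imp_le)
    define \<beta> where "\<beta> = (B powr (- 2 * d)) ^ L"
    have dyadic: "(\<Sum>w\<in>T j. word_weight B w powr - s1) \<le> 2 * 16 powr s * \<beta> * r ^ j" for j
    proof -
      define Z where "Z = B ^ (2 * L) * (2 ^ j)\<^sup>2"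
      have Z: "0 < Z" using assms(1) by (simp add: Z_def)
      have "(\<Sum>w\<in>T j. word_weight B w powr - s1) \<le> (\<Sum>w\<in>T j. Z powr - s1)"
      proof (rule sum_mono)
        fix w assume "w \<in> T j"
        then have w: "g w = j" "length w = L" using S(2) by (auto simp: T_def pos_words_def)
        have "(2 ^ j)\<^sup>2 \<le> (denom w 0)\<^sup>2" using g(1)[of w] w by (intro power_mono) auto
        then have "Z \<le> word_weight B w"
          unfolding Z_def word_weight_def w using assms(1) by (intro mult_left_mono) auto
        then show "word_weight B w powr - s1 \<le> Z powr - s1"
          using Z s1(2) by (intro powr_mono2') auto
      qed
      also have "\<dots> = real (card (T j)) * Z powr - s1" by simp
      also have "\<dots> \<le> 2 * (B ^ (2 * L) * (4 * 2 ^ j)\<^sup>2) powr s * Z powr - s1"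
        using small by (intro mult_right_mono) auto
      also have "B ^ (2 * L) * (4 * 2 ^ j)\<^sup>2 = 16 * Z" by (simp add: Z_def power_mult_distrib)
      also have "2 * (16 * Z) powr s * Z powr - s1 = 2 * 16 powr s * Z powr - d"
        using Z by (simp add: powr_mult d_def powr_add[symmetric])
      also have "Z powr - d = \<beta> * r ^ j"
      proof -
        have "(B ^ (2 * L)) powr - d = \<beta>"
          using assms(1) by (simp add: \<beta>_def powr_realpow[symmetric] powr_powr algebra_simps)
        moreover have "((2 ^ j)\<^sup>2) powr - d = r ^ j"
        proof -
          have "((2::real) ^ j)\<^sup>2 = 4 powr real j" by (simp add: powr_realpow power_mult[symmetric] mult.commute[of j] power_mult)
          then show ?thesis by (simp add: r_def powr_powr powr_realpow[symmetric] mult.commute)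
        qed
        ultimately show ?thesis unfolding Z_def using assms(1) by (simp add: powr_mult)
      qed
      finally show ?thesis by (simp add: mult.assoc)
    qed
    obtain k where k: "g ` S \<subseteq> {..<k}"
      using S(1) finite_nat_iff_bounded[of "g ` S"] by blast
    have "(\<Sum>w\<in>S. word_weight B w powr - s1) = (\<Sum>j\<in>g ` S. \<Sum>w\<in>T j. word_weight B w powr - s1)"
      unfolding T_def by (rule sum.image_gen[OF S(1)])
    also have "\<dots> \<le> (\<Sum>j\<in>g ` S. 2 * 16 powr s * \<beta> * r ^ j)" by (intro sum_mono dyadic)
    also have "\<dots> \<le> (\<Sum>j<k. 2 * 16 powr s * \<beta> * r ^ j)"
      using r by (intro sum_mono2[OF _ k]) (auto simp: \<beta>_def)
    also have "\<dots> = 2 * 16 powr s * \<beta> * (\<Sum>j<k. r ^ j)" by (simp add: sum_distrib_left)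
    also have "\<dots> \<le> 2 * 16 powr s * \<beta> * (1 / (1 - r))"
    proof (intro mult_left_mono)
      show "(\<Sum>j<k. r ^ j) \<le> 1 / (1 - r)" using r by (simp add: sum_gp_strict divide_right_mono)
    qed (auto simp: \<beta>_def)
    also have "\<dots> < 1" using L(1) by (simp add: K_def \<beta>_def)
    finally show False using S(3) by simp
  qed
  then obtain j where j: "2 * (B ^ (2 * L) * (4 * 2 ^ j)\<^sup>2) powr s \<le> real (card (T j))" by blast
  have "denom w x \<le> 4 * 2 ^ j" if "w \<in> T j" "x \<in> {0..1}" for w x
  proof -
    have "\<forall>b\<in>set w. 1 \<le> b" using that(1) S(2) by (auto simp: T_def pos_words_def)
    from denom_le_double[OF this that(2)] show ?thesis using g(2)[of w] that(1) by (simp add: T_def)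
  qed
  moreover have "finite (T j)" "T j \<subseteq> pos_words L" using S by (auto simp: T_def)
  moreover have "1 \<le> 4 * (2::real) ^ j" using one_le_power[of "2::real" j] by linarith
  ultimately show ?thesis using L(2) j by blast
qed

section \<open>Separation of images of distinct words\<close>

lemma branch_digit_diff_ge:
  assumes "y \<in> {1/2..<1}" "y' \<in> {1/2..<1}" "b \<noteq> b'"
  shows "\<bar>real b - real b'\<bar> / (2 * ((real b + 2) * (real b' + 2))) \<le> \<bar>branch [b] y - branch [b'] y'\<bar>"
proof -
  let ?u = "real b + 1 + y" and ?u' = "real b' + 1 + y'"
  have pos: "0 < ?u" "0 < ?u'" using assms by auto
  \<comment> \<open>Digits differ by at least 1 and tails by at most 1/2, so the tails cancel at
    most half of the digit difference.\<close>
  have "1 \<le> \<bar>real b - real b'\<bar>" using assms(3) by linarith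
  moreover have "\<bar>y - y'\<bar> \<le> 1 / 2" using assms(1,2) unfolding atLeastLessThan_iff by linarith
  moreover have "\<bar>real b - real b'\<bar> \<le> \<bar>?u - ?u'\<bar> + \<bar>y - y'\<bar>"
    using abs_triangle_ineq4[of "?u - ?u'" "y - y'"] by simp
  moreover have "d / 2 \<le> u" if "1 \<le> d" "e \<le> 1 / 2" "d \<le> u + e" for d e u :: real
    using that by simp
  ultimately have "\<bar>real b - real b'\<bar> / 2 \<le> \<bar>?u - ?u'\<bar>" by blast
  moreover have "?u * ?u' \<le> (real b + 2) * (real b' + 2)" using assms(1,2) by (intro mult_mono) auto
  ultimately have "\<bar>real b - real b'\<bar> / 2 / ((real b + 2) * (real b' + 2)) \<le> \<bar>?u - ?u'\<bar> / (?u * ?u')"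
    using pos by (intro frac_le mult_pos_pos) auto
  also have "\<dots> = \<bar>(?u - ?u') / (?u * ?u')\<bar>" using pos by (simp add: abs_mult)
  also have "(?u - ?u') / (?u * ?u') = branch [b] y - branch [b'] y'"
    using pos by (simp add: diff_frac_eq mult.commute)
  finally show ?thesis by simp
qed

text \<open>Each common leading letter shrinks distances by at most (M + 2)^2, and the first
  differing letter is handled by \<open>branch_digit_diff_ge\<close>. The bound depends only on M
  and the length, hence is uniform over all ordinary stages.\<close>

lemma branch_word_diff_ge:
  assumes "y \<in> {1/2..<1}" "y' \<in> {1/2..<1}" "length w = length w'" "w \<noteq> w'"
    and "\<forall>b\<in>set w \<union> set w'. 1 \<le> b \<and> b \<le> M"
  shows "1 / 2 * (1 / (real M + 2)\<^sup>2) ^ length w \<le> \<bar>branch w y - branch w' y'\<bar>"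
  using assms(3-5)
proof (induction w w' rule: list_induct2)
  case (Cons b w b' w')
  let ?m = "1 / (real M + 2)\<^sup>2"
  have z: "branch w y \<in> {1/2..<1}" "branch w' y' \<in> {1/2..<1}"
    using Cons.prems(2) assms(1,2) by (auto intro!: branch_in_half simp del: atLeastLessThan_iff)
  have m: "0 \<le> ?m" "?m \<le> 1" by (auto simp: one_le_power)
  show ?case
  proof (cases "b = b'")
    case True
    let ?u = "real b + 1 + branch w y" and ?u' = "real b + 1 + branch w' y'"
    have pos: "0 < ?u" "0 < ?u'" using z by auto
    have "?u * ?u' \<le> (real M + 2) * (real M + 2)"
      using z Cons.prems(2) by (intro mult_mono) auto
    then have le: "?u * ?u' \<le> (real M + 2)\<^sup>2" by (simp add: power2_eq_square)
    have "1 / 2 * ?m ^ length w \<le> \<bar>branch w y - branch w' y'\<bar>"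
      using Cons.IH Cons.prems True by auto
    then have "1 / 2 * ?m ^ length w / (real M + 2)\<^sup>2 \<le> \<bar>branch w y - branch w' y'\<bar> / (?u * ?u')"
      using pos le by (intro frac_le mult_pos_pos) auto
    also have "\<dots> = \<bar>(?u - ?u') / (?u * ?u')\<bar>" using pos by (simp add: abs_mult)
    also have "(?u - ?u') / (?u * ?u') = branch (b # w) y - branch (b' # w') y'"
      using pos True by (simp add: diff_frac_eq mult.commute)
    finally show ?thesis by simp
  next
    case False
    have "1 / 2 * ?m ^ length (b # w) \<le> 1 / 2 * ?m"
      using m power_decreasing[of 1 "length (b # w)" ?m] by simp
    also have "\<dots> = 1 / (2 * ((real M + 2) * (real M + 2)))" by (simp add: power2_eq_square)
    also have "\<dots> \<le> \<bar>real b - real b'\<bar> / (2 * ((real b + 2) * (real b' + 2)))"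
      using Cons.prems(2) False by (intro frac_le mult_left_mono mult_mono) auto
    also have "\<dots> \<le> \<bar>branch (b # w) y - branch (b' # w') y'\<bar>"
      using branch_digit_diff_ge[OF z False] by simp
    finally show ?thesis .
  qed
qed simp

section \<open>Schedule of ordinary and special stages\<close>

locale stage_schedule =
  fixes B s Q\<^sub>0 :: real and L n M :: nat and block :: "nat \<Rightarrow> nat list"
  assumes B: "1 < B" and s: "0 < s" "s \<le> 1" and L: "1 \<le> L"
    and block: "\<And>i. i < n \<Longrightarrow> block i \<in> pos_words L" "inj_on block {..<n}"
    and block_le: "\<And>i b. i < n \<Longrightarrow> b \<in> set (block i) \<Longrightarrow> b \<le> M"
    and Q\<^sub>0: "1 \<le> Q\<^sub>0" "\<And>i x. i < n \<Longrightarrow> x \<in> {0..1} \<Longrightarrow> denom (block i) x \<le> Q\<^sub>0"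
    and n: "2 * (B ^ (2 * L) * Q\<^sub>0\<^sup>2) powr s \<le> real n"
begin

text \<open>After l even digits the next one has index 2 (l + 1) in the full expansion, hence the
  exponent.\<close>

definition threshold :: "nat \<Rightarrow> real" where
  "threshold l = B ^ (2 * (l + 1))"

definition big_digit :: "nat \<Rightarrow> nat" where
  "big_digit l = nat \<lceil>threshold l\<rceil>"

text \<open>
  A state is the number of digits chosen so far together with the product of the mass of a
  cylinder and the \<open>2s\<close>-th power of the bound on its denominator.
\<close>
definition special_state :: "nat \<times> real \<Rightarrow> bool" where
  "special_state = (\<lambda>(l, e). e * threshold l powr s \<le> 1)"

primrec state :: "nat \<Rightarrow> nat \<times> real" where
  "state 0 = (0, 1)"
| "state (Suc j) = (case state j of (l, e) \<Rightarrow>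
    if special_state (l, e) then (l + 1, e * ((4 * real (big_digit l))\<^sup>2) powr s / real (big_digit l))
    else (l + L, e * (Q\<^sub>0\<^sup>2) powr s / real n))"

abbreviation "len j \<equiv> fst (state j)"
abbreviation "energy j \<equiv> snd (state j)"
abbreviation "special j \<equiv> special_state (state j)"

definition radix :: "nat \<Rightarrow> nat" where
  "radix j = (if special j then big_digit (len j) else n)"

text \<open>With X = \<open>big_digit (len j)\<close>, a special stage offers the X digits from X to
  2 X - 1: all reach the threshold and agree up to a factor 2, which permits a uniform choice in
  base X.\<close>

definition stage_word :: "nat \<Rightarrow> nat \<Rightarrow> nat list" where
  "stage_word j i = (if special j then [big_digit (len j) + i] else block i)"

definition denom_bound :: "nat \<Rightarrow> real" where
  "denom_bound j = (if special j then 4 * real (big_digit (len j)) else Q\<^sub>0)"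

lemma len_Suc: "len (Suc j) = (if special j then len j + 1 else len j + L)"
  by (simp split: prod.split)

lemma energy_Suc: "energy (Suc j) = energy j * ((denom_bound j)\<^sup>2) powr s / real (radix j)"
  by (simp add: radix_def denom_bound_def split: prod.split)

lemma special_iff: "special j \<longleftrightarrow> energy j * threshold (len j) powr s \<le> 1"
  by (simp add: special_state_def split: prod.split)

lemma threshold_gt_1: "1 < threshold l"
  unfolding threshold_def using B by (intro one_less_power) auto

lemma big_digit_bounds: "threshold l \<le> real (big_digit l)" "real (big_digit l) \<le> 2 * threshold l"
  using threshold_gt_1[of l] unfolding big_digit_def by linarith+

lemma big_digit_ge_2: "2 \<le> big_digit l"
proof -
  have "1 < real (big_digit l)" using threshold_gt_1[of l] big_digit_bounds(1)[of l] by linarith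
  then show ?thesis by linarith
qed

lemma n_ge_2: "2 \<le> n"
proof -
  have "1 \<le> B ^ (2 * L)" "1 \<le> Q\<^sub>0\<^sup>2" using B Q\<^sub>0(1) by (auto intro: one_le_power)
  then have "1 * 1 \<le> B ^ (2 * L) * Q\<^sub>0\<^sup>2" by (intro mult_mono) auto
  then have "1 \<le> (B ^ (2 * L) * Q\<^sub>0\<^sup>2) powr s" using s by (intro ge_one_powr_ge_zero) auto
  then show ?thesis using n by linarith
qed

lemma radix_ge_2: "2 \<le> radix j"
  using big_digit_ge_2 n_ge_2 by (simp add: radix_def)

lemma denom_bound_ge_1: "1 \<le> denom_bound j"
  using big_digit_ge_2[of "len j"] Q\<^sub>0(1) by (simp add: denom_bound_def)

lemma stage_word_nonempty: "i < radix j \<Longrightarrow> stage_word j i \<noteq> []"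
  using block(1)[of i] L by (auto simp: stage_word_def radix_def pos_words_def split: if_splits)

lemma stage_word_pos: "i < radix j \<Longrightarrow> b \<in> set (stage_word j i) \<Longrightarrow> 1 \<le> b"
  using block(1)[of i] big_digit_ge_2[of "len j"]
  by (auto simp: stage_word_def radix_def pos_words_def split: if_splits)

lemma length_stage_word: "i < radix j \<Longrightarrow> len j + length (stage_word j i) = len (Suc j)"
  using block(1)[of i] by (auto simp: stage_word_def radix_def pos_words_def len_Suc simp del: state.simps split: if_splits)

lemma denom_stage_word_le:
  assumes "i < radix j" "x \<in> {0..1}"
  shows "denom (stage_word j i) x \<le> denom_bound j"
proof (cases "special j")
  case True
  then have "i < big_digit (len j)" using assms(1) by (simp add: radix_def)
  then have "real i + 1 \<le> real (big_digit (len j))" by linarith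
  then show ?thesis using True assms(2) big_digit_ge_2[of "len j"]
    by (simp add: stage_word_def denom_bound_def)
qed (use assms Q\<^sub>0(2) in \<open>simp add: stage_word_def denom_bound_def radix_def\<close>)

text \<open>Shows that an energy bound is a Hoelder bound: the parameter length of a cylinder is at
  most a constant times (1 / Q^2)^s, where Q bounds the denominators of its prefix and 1 / Q^2
  bounds the contraction ratio from below.\<close>

lemma energy_eq: "energy j = (\<Prod>k<j. 1 / real (radix k)) * ((\<Prod>k<j. denom_bound k)\<^sup>2) powr s"
proof (induction j)
  case (Suc j)
  have "0 \<le> (\<Prod>k<j. denom_bound k)" using denom_bound_ge_1 by (intro prod_nonneg) (auto intro: order_trans[of 0 1])
  then show ?case unfolding energy_Suc by (simp add: Suc power_mult_distrib powr_mult)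
qed simp

lemma energy_pos: "0 < energy j"
proof -
  have "0 < (\<Prod>k<j. denom_bound k)" "0 < (\<Prod>k<j. 1 / real (radix k))"
    using denom_bound_ge_1 radix_ge_2 by (auto intro!: prod_pos simp: less_le_trans[of 0 1] less_le_trans[of 0 2])
  moreover have "0 < x * (y\<^sup>2) powr s" if "0 < y" "0 < x" for x y :: real using that by simp
  ultimately show ?thesis unfolding energy_eq by blast
qed

lemma energy_special_le:
  assumes "special j"
  shows "energy j \<le> (real (big_digit (len j)) / 2) powr - s"
proof -
  let ?X = "real (big_digit (len j))"
  have "energy j \<le> threshold (len j) powr - s"
    using assms threshold_gt_1[of "len j"] by (simp add: special_iff powr_minus_divide field_simps)
  also have "\<dots> \<le> (?X / 2) powr - s"
    using big_digit_bounds(2)[of "len j"] big_digit_ge_2[of "len j"] s by (intro powr_mono2') auto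
  finally show ?thesis .
qed

text \<open>An ordinary stage cannot raise the energy, as n is at least (Q0^2)^s. A special stage
  resets it: the energy before is at most (X / 2)^(-s), and the factor (16 X^2)^s / X turns this
  into (32 X)^s / X, at most 32 because s \<le> 1.\<close>

lemma energy_le: "energy j \<le> 32"
proof (induction j)
  case (Suc j)
  show ?case
  proof (cases "special j")
    case True
    let ?X = "real (big_digit (len j))"
    have X: "2 \<le> ?X" using big_digit_ge_2[of "len j"] by simp
    have "energy (Suc j) = energy j * ((4 * ?X)\<^sup>2) powr s / ?X"
      unfolding energy_Suc using True by (simp add: denom_bound_def radix_def)
    also have "\<dots> \<le> (?X / 2) powr - s * ((4 * ?X)\<^sup>2) powr s / ?X"
      by (intro divide_right_mono mult_right_mono energy_special_le[OF True]) auto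
    also have "(?X / 2) powr - s * ((4 * ?X)\<^sup>2) powr s = ((4 * ?X)\<^sup>2 / (?X / 2)) powr s"
    proof -
      have "a powr - s * b powr s = (b / a) powr s" if "0 < a" "0 \<le> b" for a b :: real
        using that by (simp add: powr_divide powr_minus_divide)
      then show ?thesis using X by simp
    qed
    also have "(4 * ?X)\<^sup>2 / (?X / 2) = 32 * ?X" using X by (simp add: power2_eq_square)
    also have "(32 * ?X) powr s / ?X \<le> (32 * ?X) powr 1 / ?X"
      using X s by (intro divide_right_mono powr_mono) auto
    also have "\<dots> = 32" using X by simp
    finally show ?thesis .
  next
    case False
    have "1 * Q\<^sub>0\<^sup>2 \<le> B ^ (2 * L) * Q\<^sub>0\<^sup>2" using B by (intro mult_right_mono) auto
    then have "(Q\<^sub>0\<^sup>2) powr s \<le> (B ^ (2 * L) * Q\<^sub>0\<^sup>2) powr s" using s by (intro powr_mono2) auto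
    then have "(Q\<^sub>0\<^sup>2) powr s \<le> real n" using n powr_ge_zero[of "Q\<^sub>0\<^sup>2" s] by linarith
    then have "energy j * ((Q\<^sub>0\<^sup>2) powr s / real n) \<le> energy j * 1"
      using energy_pos[of j] n_ge_2 by (intro mult_left_mono) auto
    then show ?thesis using False Suc unfolding energy_Suc by (simp add: denom_bound_def radix_def)
  qed
qed simp

text \<open>Each ordinary stage at least halves the quantity that \<^const>\<open>special_state\<close> compares with \<open>1\<close>.\<close>
lemma special_infinitely_often: "\<exists>j\<ge>j\<^sub>0. special j"
proof (rule ccontr)
  assume "\<nexists>j. j\<^sub>0 \<le> j \<and> special j"
  then have ord: "\<not> special j" if "j\<^sub>0 \<le> j" for j using that by blast
  define v where "v j = energy j * threshold (len j) powr s" for j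
  have step: "v (Suc j) \<le> v j / 2" if "j\<^sub>0 \<le> j" for j
  proof -
    \<comment> \<open>L new digits raise the threshold by B^(2L); the lower bound for n pays for
      this together with Q0, and its leading factor 2 gives the halving.\<close>
    have "threshold (len (Suc j)) = threshold (len j) * B ^ (2 * L)"
      using ord[OF that] unfolding len_Suc threshold_def by (simp add: power_add[symmetric] algebra_simps)
    then have "v (Suc j) = v j * ((B ^ (2 * L) * Q\<^sub>0\<^sup>2) powr s / real n)"
      using ord[OF that] B threshold_gt_1[of "len j"] unfolding v_def energy_Suc
      by (simp add: denom_bound_def radix_def powr_mult mult_ac)
    also have "\<dots> \<le> v j * (1 / 2)"
      using n n_ge_2 energy_pos[of j] by (intro mult_left_mono) (auto simp: field_simps v_def)
    finally show ?thesis by simp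
  qed
  have "v (j\<^sub>0 + k) \<le> v j\<^sub>0 * (1 / 2) ^ k" for k
  proof (induction k)
    case (Suc k)
    then show ?case using step[of "j\<^sub>0 + k"] by simp
  qed simp
  moreover have "1 < v (j\<^sub>0 + k)" for k using ord[of "j\<^sub>0 + k"] by (simp add: special_iff v_def)
  ultimately have "1 \<le> v j\<^sub>0 * (1 / 2) ^ k" for k by (meson less_imp_le order_trans)
  moreover have "(\<lambda>k. v j\<^sub>0 * (1 / 2) ^ k) \<longlonglongrightarrow> v j\<^sub>0 * 0"
    by (intro tendsto_mult tendsto_const LIMSEQ_realpow_zero) auto
  ultimately have "1 \<le> v j\<^sub>0 * 0" by (intro LIMSEQ_le_const) auto
  then show False by simp
qed

definition gap :: real where
  "gap = 1 / 2 * (1 / (real M + 2)\<^sup>2) ^ L"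

text \<open>The two entries are the constants from the special and the ordinary case of
  \<open>stage_separation\<close>.\<close>

definition holder_const :: real where
  "holder_const = max 128 (32 / gap powr s)"

lemma gap_pos: "0 < gap"
  by (simp add: gap_def)

text \<open>At ordinary stages distinct blocks are at least \<open>gap\<close> apart and the energy
  is at most 32. At special stages images can be as close as order X^(-2), which the small energy at
  that moment compensates.\<close>

lemma stage_separation:
  assumes i: "i < radix j" "i' < radix j" "i \<noteq> i'" and y: "y \<in> {1/2..<1}" "y' \<in> {1/2..<1}"
  shows "(\<bar>real i - real i'\<bar> + 1) / real (radix j) * energy j
    \<le> holder_const * \<bar>branch (stage_word j i) y - branch (stage_word j i') y'\<bar> powr s"
proof (cases "special j")
  case True
  let ?X = "real (big_digit (len j))" and ?r = "\<bar>real i - real i'\<bar>"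
  let ?D = "\<bar>branch (stage_word j i) y - branch (stage_word j i') y'\<bar>"
  have X: "2 \<le> ?X" using big_digit_ge_2[of "len j"] by simp
  have iX: "real i + 1 \<le> ?X" "real i' + 1 \<le> ?X" using i True by (auto simp: radix_def)
  have r: "1 \<le> ?r" "?r \<le> ?X" using i(3) iX by linarith+
  \<comment> \<open>Each digit plus 2 is at most 4 X, since digits are at most 2 X - 1 and X \<ge>
    2.\<close>
  have "?r / (2 * ((4 * ?X) * (4 * ?X)))
      \<le> ?r / (2 * ((real (big_digit (len j) + i) + 2) * (real (big_digit (len j) + i') + 2)))"
    using iX X by (intro divide_left_mono mult_left_mono mult_mono) auto
  also have "\<dots> \<le> ?D"
    using branch_digit_diff_ge[OF y, of "big_digit (len j) + i" "big_digit (len j) + i'"] i(3) True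
    by (simp add: stage_word_def)
  finally have D: "?r / ?X / (32 * ?X) \<le> ?D" by (simp add: field_simps)
  have "(?r + 1) / ?X * energy j \<le> (2 * (?r / ?X)) * (?X / 2) powr - s"
    using energy_special_le[OF True] energy_pos[of j] r X by (intro mult_mono) (auto simp: divide_right_mono)
  \<comment> \<open>The base 32 X is produced to match the lower bound r / X / (32 X) for the
    distance; then r / X \<le> (r / X)^s because s \<le> 1, and 2 times 64^s is at most 128.\<close>
  also have "(?X / 2) powr - s = 64 powr s * (32 * ?X) powr - s"
  proof -
    have "?X / 2 = (32 * ?X) / 64" by simp
    then show ?thesis using X by (simp only: powr_divide powr_minus_divide) simp
  qed
  also have "2 * (?r / ?X) * (64 powr s * (32 * ?X) powr - s) \<le> 2 * (?r / ?X) powr s * (64 powr 1 * (32 * ?X) powr - s)"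
    using s r X powr_mono'[of s 1 "?r / ?X"] by (intro mult_mono mult_left_mono mult_right_mono powr_mono) auto
  also have "\<dots> = 128 * (?r / ?X / (32 * ?X)) powr s"
  proof -
    have "2 * u powr s * (64 powr 1 * v powr - s) = 128 * (u / v) powr s" if "0 \<le> u" "0 < v" for u v :: real
      using that by (simp add: powr_divide powr_minus_divide)
    then show ?thesis using X by simp
  qed
  also have "\<dots> \<le> 128 * ?D powr s"
    using D s r X by (intro mult_left_mono powr_mono2) auto
  also have "\<dots> \<le> holder_const * ?D powr s" by (intro mult_right_mono) (auto simp: holder_const_def)
  finally show ?thesis using True by (simp add: radix_def)
next
  case False
  let ?D = "\<bar>branch (block i) y - branch (block i') y'\<bar>"
  have i': "i < n" "i' < n" using i False by (auto simp: radix_def)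
  have ne: "block i \<noteq> block i'" using inj_onD[OF block(2), of i i'] i' i(3) by auto
  have D: "gap \<le> ?D"
    using branch_word_diff_ge[OF y, of "block i" "block i'" M] block(1)[OF i'(1)] block(1)[OF i'(2)]
      block_le i' ne by (auto simp: pos_words_def gap_def)
  have "real i + 1 \<le> real n" "real i' + 1 \<le> real n" using i' by linarith+
  then have "\<bar>real i - real i'\<bar> + 1 \<le> real n" by linarith
  then have "(\<bar>real i - real i'\<bar> + 1) / real n * energy j \<le> 1 * 32"
    using energy_le[of j] energy_pos[of j] n_ge_2 by (intro mult_mono) auto
  also have "\<dots> = 32 / gap powr s * gap powr s" using gap_pos by simp
  also have "\<dots> \<le> holder_const * ?D powr s"
    using D gap_pos s by (intro mult_mono powr_mono2) (auto simp: holder_const_def)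
  finally show ?thesis using False by (simp add: radix_def stage_word_def)
qed

definition param_digits :: "real \<Rightarrow> nat \<Rightarrow> nat list" where
  "param_digits t j = stage_word j (radix_digit radix t j)"

lemma radix_digit_radix_less: "t \<in> {0..<1} \<Longrightarrow> radix_digit radix t j < radix j"
  using radix_ge_2[of j] by (intro radix_digit_less) auto

lemma word_limit_param_digits_expanding:
  assumes "t \<in> {0..<1}" "t' \<in> {0..<1}"
  shows "\<bar>t - t'\<bar> \<le> holder_const * \<bar>word_limit (param_digits t) - word_limit (param_digits t')\<bar> powr s"
  unfolding param_digits_def
proof (rule word_limit_radix_expanding[where Q = denom_bound])
  fix j i i' :: nat and y y' :: real
  assume *: "i < radix j" "i' < radix j" "i \<noteq> i'" "y \<in> {1/2..<1}" "y' \<in> {1/2..<1}"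
  let ?P = "\<Prod>k<j. 1 / real (radix k)" and ?Q = "(\<Prod>k<j. denom_bound k)\<^sup>2"
  let ?D = "\<bar>branch (stage_word j i) y - branch (stage_word j i') y'\<bar>"
  have "0 < (\<Prod>k<j. denom_bound k)"
    using denom_bound_ge_1 by (auto intro!: prod_pos simp: less_le_trans[of 0 1])
  then have Q: "0 < ?Q" by (rule zero_less_power)
  have "(\<bar>real i - real i'\<bar> + 1) / real (radix j) * ?P * ?Q powr s \<le> holder_const * ?D powr s"
    using stage_separation[OF *] unfolding energy_eq by (simp add: mult.assoc)
  then show "(\<bar>real i - real i'\<bar> + 1) / real (radix j) * ?P \<le> holder_const * (?D / ?Q) powr s"
    using Q by (simp add: powr_divide pos_le_divide_eq)
next
  show "0 \<le> holder_const" unfolding holder_const_def by linarith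
qed (use radix_ge_2 stage_word_nonempty stage_word_pos denom_stage_word_le s assms in auto)

lemma length_param_prefix: "t \<in> {0..<1} \<Longrightarrow> length (word_prefix (param_digits t) j) = len j"
proof (induction j)
  case (Suc j)
  then show ?case using length_stage_word[OF radix_digit_radix_less, of t j]
    by (simp add: param_digits_def del: state.simps)
qed simp

lemma le_len: "j \<le> len j"
proof (induction j)
  case (Suc j)
  then show ?case using L by (auto simp: len_Suc simp del: state.simps)
qed simp

lemma word_limit_param_digits_in_F_set:
  assumes t: "t \<in> {0..<1}"
  shows "word_limit (param_digits t) \<in> F_set B"
proof -
  let ?x = "word_limit (param_digits t)" and ?u = "word_prefix (param_digits t)"
  note digit = radix_digit_radix_less[OF t]
  have pos: "1 \<le> b" if "b \<in> set (param_digits t j)" for b j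
    using stage_word_pos[OF digit] that unfolding param_digits_def by blast
  have nonempty: "param_digits t j \<noteq> []" for j
    unfolding param_digits_def by (rule stage_word_nonempty[OF digit])
  have tail: "word_limit (\<lambda>k. param_digits t (j + k)) \<in> {1/2..<1}" for j
    using nonempty pos by (rule word_limit_gt_half)
  have pos': "\<forall>b\<in>set (?u j). 1 \<le> b" for j using pos by auto
  have pq: "partial_quotient ?x (2 * k + 1) = 1" "partial_quotient ?x (2 * Suc k) = ?u j ! k"
    if "k < len j" for k j
    using partial_quotient_branch[OF tail[of j] pos', of k j] word_limit_prefix[of "param_digits t" j]
      that length_param_prefix[OF t, of j] by auto
  have "?x \<in> I_even"
    unfolding I_even_def
  proof (intro CollectI conjI allI)
    show "?x \<in> {0..<1}" using tail[of 0] by simp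
    show "partial_quotient ?x (2 * k + 1) = 1" for k
      by (rule pq(1)[of k "Suc k"]) (use le_len[of "Suc k"] in linarith)
  qed
  moreover have "\<exists>m>m\<^sub>0. B ^ (2 * m) \<le> real (partial_quotient ?x (2 * m))" for m\<^sub>0
  proof -
    \<comment> \<open>Since j \<le> \<open>len j\<close>, a late special stage has its large digit
      late in the expansion. That digit has list position \<open>len j\<close>, counted from 0,
      hence index 2 (len j + 1) in the full expansion.\<close>
    obtain j where j: "m\<^sub>0 \<le> j" "special j" using special_infinitely_often by blast
    let ?l = "len j"
    have "?u (Suc j) ! ?l = param_digits t j ! 0"
      using length_param_prefix[OF t, of j] nonempty[of j] by (simp add: nth_append)
    also have "\<dots> \<ge> big_digit ?l" using j(2) by (simp add: param_digits_def stage_word_def)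
    finally have "real (big_digit ?l) \<le> real (?u (Suc j) ! ?l)" by simp
    moreover have "?l < len (Suc j)" using L by (simp add: len_Suc del: state.simps)
    ultimately have "B ^ (2 * Suc ?l) \<le> real (partial_quotient ?x (2 * Suc ?l))"
      using pq(2)[of ?l "Suc j"] big_digit_bounds(1)[of ?l] by (simp add: threshold_def)
    moreover have "m\<^sub>0 < Suc ?l" using j(1) le_len[of j] by linarith
    ultimately show ?thesis by blast
  qed
  ultimately show ?thesis by (auto simp: F_set_def INFM_nat)
qed

lemma hausdorff_measure_F_set_neq_0_le:
  assumes "0 \<le> s'" "s' \<le> s"
  shows "hausdorff_measure s' (F_set B) \<noteq> 0"
proof (rule hausdorff_measure_pos_of_expanding_param[where X = "\<lambda>t. word_limit (param_digits t)"])
  show "0 < holder_const" unfolding holder_const_def by linarith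
qed (use assms word_limit_param_digits_in_F_set word_limit_param_digits_expanding in
    \<open>auto simp: dist_real_def\<close>)

end

section \<open>Combination of the bounds\<close>

lemma s_limit_le_1: "1 < B \<Longrightarrow> s_limit B \<le> 1"
  using s_limit_le_s_level[of B 1] s_level_le[OF _ _ level_sum_le_one, of B 1] by simp

lemma hausdorff_measure_F_set_neq_0:
  assumes "1 < B" "0 \<le> s'" "s' < s_limit B"
  shows "hausdorff_measure s' (F_set B) \<noteq> 0"
proof -
  \<comment> \<open>The midpoint is positive even when s' = 0 and is still strictly below the limit,
    as the schedule and the block construction require.\<close>
  define s where "s = (s' + s_limit B) / 2"
  have exponent: "0 < s" "s' \<le> s" "s < s_limit B" using assms(2,3) by (auto simp: s_def)
  obtain L A Q where A: "1 \<le> L" "finite A" "A \<subseteq> pos_words L" "1 \<le> Q"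
    "\<And>w x. w \<in> A \<Longrightarrow> x \<in> {0..1} \<Longrightarrow> denom w x \<le> Q"
    "2 * (B ^ (2 * L) * Q\<^sup>2) powr s \<le> real (card A)"
    using equidenominator_block_exists[OF assms(1) _ exponent(3)] exponent(1) by auto
  obtain block where block: "bij_betw block {0..<card A} A"
    using ex_bij_betw_nat_finite[OF A(2)] by blast
  then have inA: "block i \<in> A" if "i < card A" for i using bij_betwE[OF block] that by simp
  have "finite (\<Union>w\<in>A. set w)" using A(2) by simp
  then obtain M where "\<forall>b\<in>(\<Union>w\<in>A. set w). b \<le> M"
    unfolding finite_nat_set_iff_bounded_le ..
  then have M: "b \<le> M" if "w \<in> A" "b \<in> set w" for w b using that by blast
  interpret stage_schedule B s Q L "card A" M block
  proof
    show "s \<le> 1" using exponent(3) s_limit_le_1[OF assms(1)] by linarith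
    show "inj_on block {..<card A}" using block by (simp add: bij_betw_def atLeast0LessThan)
    show "block i \<in> pos_words L" if "i < card A" for i using inA[OF that] A(3) by blast
    show "b \<le> M" if "i < card A" "b \<in> set (block i)" for i b by (rule M[OF inA[OF that(1)] that(2)])
    show "denom (block i) x \<le> Q" if "i < card A" "x \<in> {0..1}" for i x by (rule A(5)[OF inA[OF that(1)] that(2)])
  qed (fact assms(1) exponent(1) A)+
  show ?thesis using hausdorff_measure_F_set_neq_0_le[OF assms(2) exponent(2)] .
qed

theorem theorem1p4:
  fixes B :: real
  assumes "B > 1"
  shows "hausdorff_dim (F_set B) = ereal (s_limit B)"
proof (rule antisym)
  show "hausdorff_dim (F_set B) \<le> ereal (s_limit B)"
  proof (rule ereal_le_epsilon2)
    fix e :: real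
    assume "0 < e"
    then have "hausdorff_measure (s_limit B + e) (F_set B) = 0"
      by (intro hausdorff_measure_F_set_eq_0[OF assms]) simp
    then have "hausdorff_dim (F_set B) \<le> ereal (s_limit B + e)"
      unfolding hausdorff_dim_def using s_limit_nonneg[OF assms] \<open>0 < e\<close> by (intro INF_lower) auto
    then show "hausdorff_dim (F_set B) \<le> ereal (s_limit B) + ereal e" by simp
  qed
  show "ereal (s_limit B) \<le> hausdorff_dim (F_set B)"
    unfolding hausdorff_dim_def
    by (intro INF_greatest) (use hausdorff_measure_F_set_neq_0[OF assms] not_less in auto)
qed

end
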